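(* Let $\mathsf{C}$ be a two-agent NS-CSG ($N=\{1,2\}$) with rewards $r$, horizon $K$ and initial state $s\in S$, and let $(\mathrm{P}_{\mathrm N})$ and $(\mathrm{P}_{\mathrm C})$ be the nonlinear programs defined in the context. If Frozen Subgame Improvement (FSI, defined in the context, run for $m_{\max}$ iterations) is adopted to solve $(\mathrm{P}_{\mathrm N})$ (respectively $(\mathrm{P}_{\mathrm C})$) approximately, then: (i) the pair $(\mu,V)$ is a feasible solution to $(\mathrm{P}_{\mathrm N})$ (respectively $(\mathrm{P}_{\mathrm C})$) at the end of each iteration $m$, that is, $\mu$ is an SPNE (respectively SPCE) and $V$ is the equilibrium payoff vector; (ii) the social welfare $\sum_{i\in N}V_i^s$ is monotonically increasing in $m$, and also monotonically increasing in $m_{\max}$.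
   Context: **NS-CSG.** A neuro-symbolic concurrent stochastic game (NS-CSG) $\mathsf{C}$ consists of agents $\mathsf{Ag}_i=(S_i,A_i,\Delta_i,\mathit{obs}_i,\delta_i)$, $i\in N=\{1,\dots,n\}$, and an environment $E=(S_E,\delta_E)$, where: $S_i=\mathit{Loc}_i\times \mathit{Per}_i$ with $\mathit{Loc}_i\subseteq\mathbb{R}^{b_i}$, $\mathit{Per}_i\subseteq\mathbb{R}^{d_i}$ finite (local states and percepts); $S_E\subseteq\mathbb{R}^e$ is a finite or infinite set; $A_i$ is a nonempty finite action set, and $A=(A_1\cup\{\bot\})\times\cdots\times(A_n\cup\{\bot\})$ is the set of joint actions with $\bot\notin\bigcup_i A_i$ an idle action; $\Delta_i:S_i\to 2^{A_i}$ gives available actions; $\mathit{obs}_i:S_1\times\cdots\times S_n\times S_E\to \mathit{Per}_i$ is an observation function (implemented by a neural network classifier; for the present purposes just a function); $\delta_i:S_i\times A\to\mathbb{P}(\mathit{Loc}_i)$ is a probabilistic transition function, where $\mathbb{P}(X)$ is the set of probability distributions on $X$; $\delta_E:S_E\times A\to S_E$ is a deterministic environment transition function. The set of global states is $S=S_1\times\cdots\times S_n\times S_E$. For $s=(s_1,\dots,s_n,s_E)\in S$ with $s_i=(\mathit{loc}_i,\mathit{per}_i)$, let $A_i(s)=\Delta_i(s_i)$ if this is nonempty and $A_i(s)=\{\bot\}$ otherwise, and $A(s)=A_1(s)\times\cdots\times A_n(s)$. For $\alpha\in A(s)$, writing $\mathit{per}_i'=\mathit{obs}_i(s)$, the next state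 is $s'=((\mathit{loc}_1',\mathit{per}_1'),\dots,(\mathit{loc}_n',\mathit{per}_n'),\delta_E(s_E,\alpha))$ with probability $\delta(s,\alpha)(s')=\prod_{i}\delta_i((\mathit{loc}_i,\mathit{per}_i'),\alpha)(\mathit{loc}_i')$, and $\delta(s,\alpha)$ is zero on all states not of this form. **Histories.** Fix a finite horizon $K$. A history in stage $\ell\in\{0,\dots,K\}$ is a sequence $h=s^0\xrightarrow{\alpha^0}s^1\cdots\xrightarrow{\alpha^{\ell-1}}s^\ell$ with $\alpha^k\in A(s^k)$ and $\delta(s^k,\alpha^k)(s^{k+1})>0$; $last(h)=s^\ell$; $h_{\le\bar\ell}$ is its prefix ending in stage $\bar\ell\le\ell$. $H^\ell$ (resp. $H^\ell_s$) is the set of histories in stage $\ell$ (resp. with $s^0=s$), $H^{<K}=\bigcup_{\ell<K}H^\ell$, $H_s^{<K}=\bigcup_{\ell<K}H_s^\ell$, $H_s=H_s^{<K}\cup H_s^K$. $\mathrm{Succ}(h)$ is the set of one-stage successors of $h\in H^{<K}$. A path from $h\in H^\ell$ is a sequence $\pi=s^\ell\xrightarrow{\alpha^\ell}\cdots\xrightarrow{\alpha^{K-1}}s^K$ of positive-probability transitions with $s^\ell=last(h)$. **Profiles.** A strategy of agent $i$ is $\sigma_i:H^{<K}\to\mathbb{P}(A_i\cup\{\bot\})$ with $\sigma_i(h)$ supported on $A_i(last(h))$; $\Sigma_i^{\mathrm N}$ is the set of these; a strategy profile is $\sigma=(\sigma_1,\dots,\sigma_n)$ (agents randomise independently). $\sigma_{-i}[\sigma_i']$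 is $\sigma$ with $\sigma_i$ replaced by $\sigma_i'$. A correlated profile is $\tau:H^{<K}\to\mathbb{P}(A)$ with $\tau(h)$ supported on $A(last(h))$. For equilibria with initial state $s$ only the values on $H_s^{<K}$ matter. **Rewards.** Each agent has reward functions $r_i^A:S\times A\to\mathbb{R}$, $r_i^S:S\to\mathbb{R}$. For a path $\pi$ from stage $\ell$, $Y_i(\pi)=\sum_{k=\ell}^{K-1}\big(r_i^A(s^k,\alpha^k)+r_i^S(s^k)\big)+r_i^S(s^K)$. $\mathbb{E}^{\sigma}_{\ell,h}[Y_i]$ (resp. $\mathbb{E}^\tau_{\ell,h}[Y_i]$) is the expectation of $Y_i$ over paths from $h\in H^\ell$ under $\sigma$ (resp. $\tau$). $\mathbb{E}^\tau_\ell[Y_i,a_i'\mid a_i,h]$ is the expectation of $Y_i$ from $h\in H^\ell$ when agent $i$ takes the action $a_i'$ instead of the recommended action $a_i$ at $h$, and otherwise the recommendation by $\tau$ is followed by all agents. **Equilibria.** For an initial state $s$: $\sigma^*$ is a subgame-perfect Nash equilibrium (SPNE) if $\mathbb{E}^{\sigma^*}_{\ell,h}[Y_i]\ge\mathbb{E}^{\sigma^*_{-i}[\sigma_i]}_{\ell,h}[Y_i]$ for all $\sigma_i\in\Sigma_i^{\mathrm N}$, $i\in N$, $\ell<K$ and $h\in H_s^\ell$. $\tau^*$ is a subgame-perfect correlated equilibrium (SPCE) if $\mathbb{E}^{\tau^*}_\ell[Y_i,a_i\mid a_i,h]\ge\mathbb{E}^{\tau^*}_\ell[Y_i,a_i'\mid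 a_i,h]$ for all $i\in N$, $\ell<K$, $h\in H_s^\ell$ and $a_i,a_i'\in A_i(last(h))$ (the condition being vacuous when $a_i$ is recommended with probability $0$ at $h$). The equilibrium payoff vector of such an equilibrium collects, for each $h$, the vector $V^h$ of the agents' expected accumulated rewards from $h$ to the end of the game under the equilibrium. **Constraint systems (two agents).** For $h\in H_s^K$ put $V^h=(r_1^S(last(h)),r_2^S(last(h)))$ (constants). For $h\in H_s^{<K}$ there are real variables $V^h=(V_1^h,V_2^h)$; for $C^{\mathrm N}$ also variables $\mu_i^h=(\mu_i^h(a_i))_{a_i\in A_i(last(h))}$, $i=1,2$ (write $\mu^h=(\mu_1^h,\mu_2^h)$); for $C^{\mathrm C}$ also variables $\mu^h=(\mu^h_\alpha)_{\alpha\in A(last(h))}$. For $h\in H_s^{<K}$ and $\alpha\in A(last(h))$ let $$\mathsf{Z}_i^{h,\alpha}=r_i^A(last(h),\alpha)+r_i^S(last(h))+\sum_{h'}\delta(last(h),\alpha)(last(h'))\,V_i^{h'},\qquad(\ast)$$ the sum being over the successors $h'=h\xrightarrow{\alpha}s'$ of $h$ via $\alpha$. Below, $A_i$ abbreviates $A_i(last(h))$, $A$ abbreviates $A(last(h))$, and $(a_i,a_j)$ is the joint action in which agent $i$ plays $a_i$ and agent $j$ plays $a_j$. $C^{\mathrm N}(\mu^{\mathrm N},V)$, with $\mu^{\mathrm N}=\{\mu_1^h,\mu_2^h\}_{h\in H_s^{<K}}$ and $V=\{V^h\}_{h\in H_s^{<K}}$, consists, for all $h\in H_s^{<K}$ and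 $i,j\in\{1,2\}$, $i\neq j$, of $(\ast)$ and - $V_i^h-\sum_{(a_i,a_j)\in A_i\times A_j}\mu_i^h(a_i)\mu_j^h(a_j)\mathsf{Z}_i^{h,(a_i,a_j)}=0$; - $V_i^h-\sum_{a_j\in A_j}\mu_j^h(a_j)\mathsf{Z}_i^{h,(a_i,a_j)}\ge 0$ for all $a_i\in A_i$; - $\sum_{a_i\in A_i}\mu_i^h(a_i)=1$ and $\mu_i^h(a_i)\ge0$ for all $a_i\in A_i$. $C^{\mathrm C}(\mu^{\mathrm C},V)$, with $\mu^{\mathrm C}=\{\mu^h\}_{h\in H_s^{<K}}$, consists, for all $h\in H_s^{<K}$ and $i,j\in\{1,2\}$, $i\ne j$, of $(\ast)$ and - $V_i^h-\sum_{\alpha\in A}\mu^h_\alpha\mathsf{Z}_i^{h,\alpha}=0$; - $\sum_{a_j\in A_j}\big(\mathsf{Z}_i^{h,(a_i,a_j)}-\mathsf{Z}_i^{h,(a_i',a_j)}\big)\mu^h_{(a_i,a_j)}\ge0$ for all $a_i,a_i'\in A_i$; - $\sum_{\alpha\in A}\mu_\alpha^h=1$ and $\mu_\alpha^h\ge0$ for all $\alpha\in A$. **Programs.** $(\mathrm{P}_{\mathrm N})$: maximise $\sum_{i\in N}V_i^s$ over $(\mu^{\mathrm N},V)$ subject to $C^{\mathrm N}(\mu^{\mathrm N},V)$. $(\mathrm{P}_{\mathrm C})$: maximise $\sum_{i\in N}V_i^s$ over $(\mu^{\mathrm C},V)$ subject to $C^{\mathrm C}(\mu^{\mathrm C},V)$.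 **Frozen Subgame Improvement (FSI).** Input: $\mathsf{C}$, $r$, equilibrium type NE (for $(\mathrm{P}_{\mathrm N})$) or CE (for $(\mathrm{P}_{\mathrm C})$), $s$, and a predefined number of iterations $m_{\max}$. 1. Initialisation by backward induction: with $V^h=(r_1^S(last(h)),r_2^S(last(h)))$ for $h\in H_s^K$, for $\ell=K-1,\dots,0$ and each $h\in H_s^\ell$, let $\mu^h$ be a Nash equilibrium (type NE) or a correlated equilibrium (type CE) of the normal-form game with action sets $A_i(last(h))$ and utilities $\mathsf{Z}_i^{h,\alpha}$ given by $(\ast)$ from the already computed $V^{h'}$, and let $V^h$ be its vector of expected utilities. This gives $(\mu,V)$; set $m=0$. 2. Repeat until $m=m_{\max}$: select a history $h\in H_s^{\ell}$ for some $\ell<K$ (for example by sampling uniformly); let $P$ be the program $(\mathrm{P}_{\mathrm N})$ or $(\mathrm{P}_{\mathrm C})$ in which the variables $\mu^{h'},V^{h'}$ are frozen at their current values for every $h'\in H_s^{<K}$ that is not a prefix of $h$ ($h$ counts as a prefix of itself), so that the free variables are $\mu^{h_{\le\bar\ell}},V^{h_{\le\bar\ell}}$ for $0\le\bar\ell\le\ell$; compute an optimal solution of $P$; replace the values of $\mu^{h_{\le\bar\ell}},V^{h_{\le\bar\ell}}$ ($\bar\ell\le\ell$) by those of this optimal solution, keeping the frozen values; increase $m$ by $1$. 3. Return $(\mu,V)$. *)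

theory Defs
  imports "HOL-Probability.Probability" "HOL-Probability.Product_PMF"
begin

section \<open>Neuro-symbolic concurrent stochastic games\<close>

text \<open>
  The agents are the elements of a finite type \<open>'i\<close>.  A point of a Euclidean space whose
  dimension depends on the agent is a real list of the appropriate length.  The idle action is
  \<open>None\<close>, so that it differs from every proper action \<open>Some a\<close>.
\<close>

type_synonym vec = "real list"
type_synonym lstate = "vec \<times> vec"
type_synonym 'i state = "('i \<Rightarrow> lstate) \<times> vec"
type_synonym ('i, 'a) jact = "'i \<Rightarrow> 'a option"

record ('i, 'a) nscsg =
  loc_dim :: "'i \<Rightarrow> nat"
  per_dim :: "'i \<Rightarrow> nat"
  env_dim :: nat
  locs :: "'i \<Rightarrow> vec set"
  pers :: "'i \<Rightarrow> vec set"
  envs :: "vec set"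
  acts :: "'i \<Rightarrow> 'a set"
  avail :: "'i \<Rightarrow> lstate \<Rightarrow> 'a set"
  obs :: "'i \<Rightarrow> 'i state \<Rightarrow> vec"
  loc_trans :: "'i \<Rightarrow> lstate \<Rightarrow> ('i, 'a) jact \<Rightarrow> vec pmf"
  env_trans :: "vec \<Rightarrow> ('i, 'a) jact \<Rightarrow> vec"

record ('i, 'a) rewards =
  act_rew :: "'i \<Rightarrow> 'i state \<Rightarrow> ('i, 'a) jact \<Rightarrow> real"
  st_rew :: "'i \<Rightarrow> 'i state \<Rightarrow> real"

definition lstates :: "('i, 'a) nscsg \<Rightarrow> 'i \<Rightarrow> lstate set" where
  "lstates G i = locs G i \<times> pers G i"

definition states :: "('i, 'a) nscsg \<Rightarrow> 'i state set" where
  "states G = {s. (\<forall>i. fst s i \<in> lstates G i) \<and> snd s \<in> envs G}"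

definition jacts :: "('i, 'a) nscsg \<Rightarrow> ('i, 'a) jact set" where
  "jacts G = {\<alpha>. \<forall>i. \<alpha> i \<in> insert None (Some ` acts G i)}"

definition is_nscsg :: "('i::finite, 'a) nscsg \<Rightarrow> bool" where
  "is_nscsg G \<longleftrightarrow>
     (\<forall>i. finite (locs G i) \<and> locs G i \<subseteq> {x. length x = loc_dim G i}) \<and>
     (\<forall>i. finite (pers G i) \<and> pers G i \<subseteq> {x. length x = per_dim G i}) \<and>
     envs G \<subseteq> {x. length x = env_dim G} \<and>
     (\<forall>i. finite (acts G i) \<and> acts G i \<noteq> {}) \<and>
     (\<forall>i. \<forall>l\<in>lstates G i. avail G i l \<subseteq> acts G i) \<and>
     (\<forall>i. \<forall>s\<in>states G. obs G i s \<in> pers G i) \<and>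
     (\<forall>i. \<forall>l\<in>lstates G i. \<forall>\<alpha>\<in>jacts G. set_pmf (loc_trans G i l \<alpha>) \<subseteq> locs G i) \<and>
     (\<forall>e\<in>envs G. \<forall>\<alpha>\<in>jacts G. env_trans G e \<alpha> \<in> envs G)"

definition choices :: "('i, 'a) nscsg \<Rightarrow> 'i state \<Rightarrow> 'i \<Rightarrow> 'a option set" where
  "choices G s i = (if avail G i (fst s i) = {} then {None} else Some ` avail G i (fst s i))"

definition joint :: "('i \<Rightarrow> 'b set) \<Rightarrow> ('i \<Rightarrow> 'b) set" where
  "joint B = {\<alpha>. \<forall>i. \<alpha> i \<in> B i}"

text \<open>
  The new percepts are determined by the current state; the new locations are drawn independently.
\<close>

definition next_state ::
  "('i::finite, 'a) nscsg \<Rightarrow> 'i state \<Rightarrow> ('i, 'a) jact \<Rightarrow> 'i state pmf" where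
  "next_state G s \<alpha> =
     map_pmf (\<lambda>l. (\<lambda>i. (l i, obs G i s), env_trans G (snd s) \<alpha>))
       (Pi_pmf UNIV [] (\<lambda>i. loc_trans G i (fst (fst s i), obs G i s) \<alpha>))"

lemma pmf_next_state:
  "pmf (next_state G s \<alpha>) s' =
     (if (\<forall>i. snd (fst s' i) = obs G i s) \<and> snd s' = env_trans G (snd s) \<alpha>
      then \<Prod>i\<in>UNIV. pmf (loc_trans G i (fst (fst s i), obs G i s) \<alpha>) (fst (fst s' i))
      else 0)"
proof -
  define f :: "('a \<Rightarrow> vec) \<Rightarrow> 'a state"
    where "f = (\<lambda>l. (\<lambda>i. (l i, obs G i s), env_trans G (snd s) \<alpha>))"
  have inj: "inj f"
    by (auto simp: inj_on_def f_def fun_eq_iff)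
  show ?thesis
  proof (cases "(\<forall>i. snd (fst s' i) = obs G i s) \<and> snd s' = env_trans G (snd s) \<alpha>")
    case True
    then have "s' = f (\<lambda>i. fst (fst s' i))"
      unfolding f_def by (intro prod_eqI ext) auto
    moreover have "pmf (next_state G s \<alpha>) (f l) =
        pmf (Pi_pmf UNIV [] (\<lambda>i. loc_trans G i (fst (fst s i), obs G i s) \<alpha>)) l" for l
      unfolding next_state_def f_def[symmetric] by (rule pmf_map_inj'[OF inj])
    ultimately have "pmf (next_state G s \<alpha>) s' =
        pmf (Pi_pmf UNIV [] (\<lambda>i. loc_trans G i (fst (fst s i), obs G i s) \<alpha>))
          (\<lambda>i. fst (fst s' i))"
      by (rule ssubst)
    with True show ?thesis
      by (simp add: pmf_Pi)
  next
    case False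
    then have "s' \<notin> f ` UNIV"
      by (auto simp: f_def)
    then have "s' \<notin> set_pmf (next_state G s \<alpha>)"
      unfolding next_state_def f_def[symmetric] by auto
    with False show ?thesis
      by (auto simp: set_pmf_iff)
  qed
qed


section \<open>Histories and paths\<close>

text \<open>
  A run consists of its first state and the list of its steps (joint action, next state).
  Histories and paths are both runs: a path from a history starts in the last state of the history.
\<close>

type_synonym ('i, 'a) run = "'i state \<times> (('i, 'a) jact \<times> 'i state) list"

definition stage :: "('i, 'a) run \<Rightarrow> nat" where
  "stage h = length (snd h)"

definition st :: "('i, 'a) run \<Rightarrow> nat \<Rightarrow> 'i state" where
  "st h k = (fst h # map snd (snd h)) ! k"

definition act :: "('i, 'a) run \<Rightarrow> nat \<Rightarrow> ('i, 'a) jact" where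
  "act h k = fst (snd h ! k)"

definition last_st :: "('i, 'a) run \<Rightarrow> 'i state" where
  "last_st h = st h (stage h)"

definition extend :: "('i, 'a) run \<Rightarrow> ('i, 'a) jact \<Rightarrow> 'i state \<Rightarrow> ('i, 'a) run" where
  "extend h \<alpha> s' = (fst h, snd h @ [(\<alpha>, s')])"

definition prefixes_of :: "('i, 'a) run \<Rightarrow> ('i, 'a) run set" where
  "prefixes_of h = {(fst h, take k (snd h)) |k. k \<le> stage h}"

definition hists :: "('i::finite, 'a) nscsg \<Rightarrow> ('i, 'a) run set" where
  "hists G = {h. fst h \<in> states G \<and>
     (\<forall>k<stage h. act h k \<in> joint (choices G (st h k)) \<and>
                  pmf (next_state G (st h k) (act h k)) (st h (Suc k)) > 0)}"

definition hists_lt :: "('i::finite, 'a) nscsg \<Rightarrow> nat \<Rightarrow> ('i, 'a) run set" where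
  "hists_lt G K = {h \<in> hists G. stage h < K}"

definition hists_lt_from ::
  "('i::finite, 'a) nscsg \<Rightarrow> nat \<Rightarrow> 'i state \<Rightarrow> ('i, 'a) run set" where
  "hists_lt_from G K s = {h \<in> hists_lt G K. fst h = s}"

text \<open>The one-stage successors of a history via a given joint action.\<close>

definition succs ::
  "('i::finite, 'a) nscsg \<Rightarrow> ('i, 'a) run \<Rightarrow> ('i, 'a) jact \<Rightarrow> ('i, 'a) run set" where
  "succs G h \<alpha> = {extend h \<alpha> s' |s'. pmf (next_state G (last_st h) \<alpha>) s' > 0}"


section \<open>Profiles and expected rewards\<close>

type_synonym ('i, 'a) strategy = "('i, 'a) run \<Rightarrow> 'a option pmf"
type_synonym ('i, 'a) cprofile = "('i, 'a) run \<Rightarrow> ('i, 'a) jact pmf"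

definition strategies :: "('i::finite, 'a) nscsg \<Rightarrow> nat \<Rightarrow> 'i \<Rightarrow> ('i, 'a) strategy set" where
  "strategies G K i = {\<sigma>. \<forall>h\<in>hists_lt G K. set_pmf (\<sigma> h) \<subseteq> choices G (last_st h) i}"

definition cprofiles :: "('i::finite, 'a) nscsg \<Rightarrow> nat \<Rightarrow> ('i, 'a) cprofile set" where
  "cprofiles G K = {\<tau>. \<forall>h\<in>hists_lt G K. set_pmf (\<tau> h) \<subseteq> joint (choices G (last_st h))}"

definition indep :: "('i::finite \<Rightarrow> ('i, 'a) strategy) \<Rightarrow> ('i, 'a) cprofile" where
  "indep \<sigma> = (\<lambda>h. Pi_pmf UNIV None (\<lambda>i. \<sigma> i h))"

text \<open>The distribution of the path formed by the next \<open>n\<close> steps after \<open>h\<close>.\<close>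

primrec paths ::
  "('i::finite, 'a) nscsg \<Rightarrow> ('i, 'a) cprofile \<Rightarrow> nat \<Rightarrow> ('i, 'a) run \<Rightarrow> ('i, 'a) run pmf" where
  "paths G \<tau> 0 h = return_pmf (last_st h, [])"
| "paths G \<tau> (Suc n) h =
     bind_pmf (\<tau> h) (\<lambda>\<alpha>.
     bind_pmf (next_state G (last_st h) \<alpha>) (\<lambda>s'.
     map_pmf (\<lambda>\<pi>. (last_st h, (\<alpha>, s') # snd \<pi>)) (paths G \<tau> n (extend h \<alpha> s'))))"

definition path_reward :: "('i, 'a) rewards \<Rightarrow> 'i \<Rightarrow> ('i, 'a) run \<Rightarrow> real" where
  "path_reward r i \<pi> =
     (\<Sum>k<stage \<pi>. act_rew r i (st \<pi> k) (act \<pi> k) + st_rew r i (st \<pi> k)) + st_rew r i (last_st \<pi>)"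

definition expected_reward ::
  "('i::finite, 'a) nscsg \<Rightarrow> ('i, 'a) rewards \<Rightarrow> nat \<Rightarrow> ('i, 'a) cprofile \<Rightarrow> 'i \<Rightarrow> ('i, 'a) run \<Rightarrow> real"
  where
  "expected_reward G r K \<tau> i h =
     measure_pmf.expectation (paths G \<tau> (K - stage h) h) (path_reward r i)"

text \<open>
  Playing \<open>a'\<close> instead of the recommendation \<open>a\<close> at \<open>h\<close>: the distribution at \<open>h\<close> is conditioned on
  the recommendation and the action is then replaced.  As \<open>h\<close> is never visited again, all later
  recommendations are those of \<open>\<tau>\<close>.  Only meaningful if \<open>a\<close> has positive probability at \<open>h\<close>.
\<close>

definition deviate ::
  "('i, 'a) cprofile \<Rightarrow> 'i \<Rightarrow> 'a option \<Rightarrow> 'a option \<Rightarrow> ('i, 'a) run \<Rightarrow> ('i, 'a) cprofile" where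
  "deviate \<tau> i a a' h =
     \<tau>(h := map_pmf (\<lambda>\<alpha>. \<alpha>(i := a')) (cond_pmf (\<tau> h) {\<alpha>. \<alpha> i = a}))"


section \<open>Subgame-perfect equilibria\<close>

definition is_SPNE ::
  "('i::finite, 'a) nscsg \<Rightarrow> ('i, 'a) rewards \<Rightarrow> nat \<Rightarrow> 'i state \<Rightarrow> ('i \<Rightarrow> ('i, 'a) strategy) \<Rightarrow> bool"
  where
  "is_SPNE G r K s \<sigma> \<longleftrightarrow>
     (\<forall>i. \<sigma> i \<in> strategies G K i) \<and>
     (\<forall>i. \<forall>\<sigma>'\<in>strategies G K i. \<forall>h\<in>hists_lt_from G K s.
        expected_reward G r K (indep \<sigma>) i h \<ge> expected_reward G r K (indep (\<sigma>(i := \<sigma>'))) i h)"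

definition is_SPCE ::
  "('i::finite, 'a) nscsg \<Rightarrow> ('i, 'a) rewards \<Rightarrow> nat \<Rightarrow> 'i state \<Rightarrow> ('i, 'a) cprofile \<Rightarrow> bool" where
  "is_SPCE G r K s \<tau> \<longleftrightarrow>
     \<tau> \<in> cprofiles G K \<and>
     (\<forall>i. \<forall>h\<in>hists_lt_from G K s.
        \<forall>a\<in>choices G (last_st h) i. \<forall>a'\<in>choices G (last_st h) i.
          measure_pmf.prob (\<tau> h) {\<alpha>. \<alpha> i = a} > 0 \<longrightarrow>
          expected_reward G r K (deviate \<tau> i a a h) i h
            \<ge> expected_reward G r K (deviate \<tau> i a a' h) i h)"


section \<open>Equilibria of normal-form games\<close>

definition prob_vecs :: "'b set \<Rightarrow> ('b \<Rightarrow> real) set" where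
  "prob_vecs B = {x. (\<forall>b\<in>B. 0 \<le> x b) \<and> (\<Sum>b\<in>B. x b) = 1}"

definition mixed_utility ::
  "('i::finite \<Rightarrow> 'b set) \<Rightarrow> (('i \<Rightarrow> 'b) \<Rightarrow> real) \<Rightarrow> ('i \<Rightarrow> 'b \<Rightarrow> real) \<Rightarrow> real" where
  "mixed_utility B u x = (\<Sum>\<alpha>\<in>joint B. (\<Prod>i\<in>UNIV. x i (\<alpha> i)) * u \<alpha>)"

definition nash_eq ::
  "('i::finite \<Rightarrow> 'b set) \<Rightarrow> ('i \<Rightarrow> ('i \<Rightarrow> 'b) \<Rightarrow> real) \<Rightarrow> ('i \<Rightarrow> 'b \<Rightarrow> real) \<Rightarrow> bool" where
  "nash_eq B u x \<longleftrightarrow>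
     (\<forall>i. x i \<in> prob_vecs (B i)) \<and>
     (\<forall>i. \<forall>y\<in>prob_vecs (B i). mixed_utility B (u i) x \<ge> mixed_utility B (u i) (x(i := y)))"

definition corr_utility ::
  "('i::finite \<Rightarrow> 'b set) \<Rightarrow> (('i \<Rightarrow> 'b) \<Rightarrow> real) \<Rightarrow> (('i \<Rightarrow> 'b) \<Rightarrow> real) \<Rightarrow> real" where
  "corr_utility B u p = (\<Sum>\<alpha>\<in>joint B. p \<alpha> * u \<alpha>)"

definition corr_eq ::
  "('i::finite \<Rightarrow> 'b set) \<Rightarrow> ('i \<Rightarrow> ('i \<Rightarrow> 'b) \<Rightarrow> real) \<Rightarrow> (('i \<Rightarrow> 'b) \<Rightarrow> real) \<Rightarrow> bool" where
  "corr_eq B u p \<longleftrightarrow>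
     p \<in> prob_vecs (joint B) \<and>
     (\<forall>i. \<forall>a\<in>B i. \<forall>a'\<in>B i.
        (\<Sum>\<alpha>\<in>{\<alpha>\<in>joint B. \<alpha> i = a}. p \<alpha> * u i \<alpha>)
          \<ge> (\<Sum>\<alpha>\<in>{\<alpha>\<in>joint B. \<alpha> i = a}. p \<alpha> * u i (\<alpha>(i := a'))))"


section \<open>The two nonlinear programs\<close>

text \<open>
  Assignments to the variables are total functions, but only the values \<open>V h i\<close>, \<open>\<mu> h i a\<close> and
  \<open>\<mu> h \<alpha>\<close> for histories \<open>h\<close> in \<open>hists_lt_from G K s\<close> and actions available at \<open>h\<close> are variables
  of the programs; nothing below depends on or constrains the other values.  In particular the
  payoffs at stage \<open>K\<close> are constants, substituted by \<open>payoff\<close>.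
\<close>

type_synonym ('i, 'a) vals = "('i, 'a) run \<Rightarrow> 'i \<Rightarrow> real"
type_synonym ('i, 'a) mixN = "('i, 'a) run \<Rightarrow> 'i \<Rightarrow> 'a option \<Rightarrow> real"
type_synonym ('i, 'a) mixC = "('i, 'a) run \<Rightarrow> ('i, 'a) jact \<Rightarrow> real"

definition payoff :: "('i, 'a) rewards \<Rightarrow> nat \<Rightarrow> ('i, 'a) vals \<Rightarrow> ('i, 'a) vals" where
  "payoff r K V h i = (if stage h = K then st_rew r i (last_st h) else V h i)"

definition Z ::
  "('i::finite, 'a) nscsg \<Rightarrow> ('i, 'a) rewards \<Rightarrow> nat \<Rightarrow> ('i, 'a) vals \<Rightarrow> ('i, 'a) run \<Rightarrow>
   'i \<Rightarrow> ('i, 'a) jact \<Rightarrow> real" where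
  "Z G r K V h i \<alpha> =
     act_rew r i (last_st h) \<alpha> + st_rew r i (last_st h) +
     (\<Sum>h'\<in>succs G h \<alpha>. pmf (next_state G (last_st h) \<alpha>) (last_st h') * payoff r K V h' i)"

definition welfare ::
  "('i::finite, 'a) rewards \<Rightarrow> nat \<Rightarrow> 'i state \<Rightarrow> ('i, 'a) vals \<Rightarrow> real" where
  "welfare r K s V = (\<Sum>i\<in>UNIV. payoff r K V (s, []) i)"

text \<open>
  The joint action of two agents in which \<open>i\<close> plays \<open>a\<close> and the other agent plays \<open>b\<close>.
  The constraint systems below are meant for exactly two agents.
\<close>

definition pair_act :: "'i \<Rightarrow> 'b \<Rightarrow> 'b \<Rightarrow> 'i \<Rightarrow> 'b" where
  "pair_act i a b = (\<lambda>k. if k = i then a else b)"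

definition feasible_N ::
  "('i::finite, 'a) nscsg \<Rightarrow> ('i, 'a) rewards \<Rightarrow> nat \<Rightarrow> 'i state \<Rightarrow>
   ('i, 'a) mixN \<times> ('i, 'a) vals \<Rightarrow> bool" where
  "feasible_N G r K s = (\<lambda>(\<mu>, V).
     \<forall>h\<in>hists_lt_from G K s. \<forall>i j. i \<noteq> j \<longrightarrow>
       (let Ai = choices G (last_st h) i; Aj = choices G (last_st h) j in
         V h i - (\<Sum>(ai, aj)\<in>Ai \<times> Aj. \<mu> h i ai * \<mu> h j aj * Z G r K V h i (pair_act i ai aj)) = 0 \<and>
         (\<forall>ai\<in>Ai. V h i - (\<Sum>aj\<in>Aj. \<mu> h j aj * Z G r K V h i (pair_act i ai aj)) \<ge> 0) \<and>
         (\<Sum>ai\<in>Ai. \<mu> h i ai) = 1 \<and>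
         (\<forall>ai\<in>Ai. \<mu> h i ai \<ge> 0)))"

definition feasible_C ::
  "('i::finite, 'a) nscsg \<Rightarrow> ('i, 'a) rewards \<Rightarrow> nat \<Rightarrow> 'i state \<Rightarrow>
   ('i, 'a) mixC \<times> ('i, 'a) vals \<Rightarrow> bool" where
  "feasible_C G r K s = (\<lambda>(\<mu>, V).
     \<forall>h\<in>hists_lt_from G K s. \<forall>i j. i \<noteq> j \<longrightarrow>
       (let Ai = choices G (last_st h) i; Aj = choices G (last_st h) j;
            A = joint (choices G (last_st h)) in
         V h i - (\<Sum>\<alpha>\<in>A. \<mu> h \<alpha> * Z G r K V h i \<alpha>) = 0 \<and>
         (\<forall>ai\<in>Ai. \<forall>ai'\<in>Ai.
            (\<Sum>aj\<in>Aj. (Z G r K V h i (pair_act i ai aj) - Z G r K V h i (pair_act i ai' aj)) *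
               \<mu> h (pair_act i ai aj)) \<ge> 0) \<and>
         (\<Sum>\<alpha>\<in>A. \<mu> h \<alpha>) = 1 \<and>
         (\<forall>\<alpha>\<in>A. \<mu> h \<alpha> \<ge> 0)))"

text \<open>
  A point \<open>(\<mu>, V)\<close> is an equilibrium with its payoff vectors if \<open>\<mu>\<close> lists the probabilities of a
  subgame-perfect equilibrium at the relevant histories and \<open>V\<close> its expected rewards.
\<close>

definition SPNE_with_payoffs ::
  "('i::finite, 'a) nscsg \<Rightarrow> ('i, 'a) rewards \<Rightarrow> nat \<Rightarrow> 'i state \<Rightarrow>
   ('i, 'a) mixN \<times> ('i, 'a) vals \<Rightarrow> bool" where
  "SPNE_with_payoffs G r K s = (\<lambda>(\<mu>, V).
     \<exists>\<sigma>. is_SPNE G r K s \<sigma> \<and>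
       (\<forall>h\<in>hists_lt_from G K s. \<forall>i.
          (\<forall>a\<in>choices G (last_st h) i. pmf (\<sigma> i h) a = \<mu> h i a) \<and>
          V h i = expected_reward G r K (indep \<sigma>) i h))"

definition SPCE_with_payoffs ::
  "('i::finite, 'a) nscsg \<Rightarrow> ('i, 'a) rewards \<Rightarrow> nat \<Rightarrow> 'i state \<Rightarrow>
   ('i, 'a) mixC \<times> ('i, 'a) vals \<Rightarrow> bool" where
  "SPCE_with_payoffs G r K s = (\<lambda>(\<mu>, V).
     \<exists>\<tau>. is_SPCE G r K s \<tau> \<and>
       (\<forall>h\<in>hists_lt_from G K s.
          (\<forall>\<alpha>\<in>joint (choices G (last_st h)). pmf (\<tau> h) \<alpha> = \<mu> h \<alpha>) \<and>
          (\<forall>i. V h i = expected_reward G r K \<tau> i h)))"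


section \<open>Frozen subgame improvement\<close>

text \<open>
  Backward induction determines the payoffs stage by stage, so its results are exactly the points
  satisfying the following local conditions at all histories.
\<close>

definition init_N ::
  "('i::finite, 'a) nscsg \<Rightarrow> ('i, 'a) rewards \<Rightarrow> nat \<Rightarrow> 'i state \<Rightarrow>
   ('i, 'a) mixN \<times> ('i, 'a) vals \<Rightarrow> bool" where
  "init_N G r K s = (\<lambda>(\<mu>, V).
     \<forall>h\<in>hists_lt_from G K s.
       nash_eq (choices G (last_st h)) (Z G r K V h) (\<mu> h) \<and>
       (\<forall>i. V h i = mixed_utility (choices G (last_st h)) (Z G r K V h i) (\<mu> h)))"

definition init_C ::
  "('i::finite, 'a) nscsg \<Rightarrow> ('i, 'a) rewards \<Rightarrow> nat \<Rightarrow> 'i state \<Rightarrow>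
   ('i, 'a) mixC \<times> ('i, 'a) vals \<Rightarrow> bool" where
  "init_C G r K s = (\<lambda>(\<mu>, V).
     \<forall>h\<in>hists_lt_from G K s.
       corr_eq (choices G (last_st h)) (Z G r K V h) (\<mu> h) \<and>
       (\<forall>i. V h i = corr_utility (choices G (last_st h)) (Z G r K V h i) (\<mu> h)))"

text \<open>The second point keeps all values of the first one that are frozen when \<open>h\<close> is selected.\<close>

definition keeps_frozen_N ::
  "('i::finite, 'a) nscsg \<Rightarrow> nat \<Rightarrow> 'i state \<Rightarrow> ('i, 'a) run \<Rightarrow>
   ('i, 'a) mixN \<times> ('i, 'a) vals \<Rightarrow> ('i, 'a) mixN \<times> ('i, 'a) vals \<Rightarrow> bool" where
  "keeps_frozen_N G K s h = (\<lambda>(\<mu>, V) (\<mu>', V').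
     \<forall>h'\<in>hists_lt_from G K s - prefixes_of h. \<forall>i.
       V' h' i = V h' i \<and> (\<forall>a\<in>choices G (last_st h') i. \<mu>' h' i a = \<mu> h' i a))"

definition keeps_frozen_C ::
  "('i::finite, 'a) nscsg \<Rightarrow> nat \<Rightarrow> 'i state \<Rightarrow> ('i, 'a) run \<Rightarrow>
   ('i, 'a) mixC \<times> ('i, 'a) vals \<Rightarrow> ('i, 'a) mixC \<times> ('i, 'a) vals \<Rightarrow> bool" where
  "keeps_frozen_C G K s h = (\<lambda>(\<mu>, V) (\<mu>', V').
     \<forall>h'\<in>hists_lt_from G K s - prefixes_of h.
       (\<forall>i. V' h' i = V h' i) \<and> (\<forall>\<alpha>\<in>joint (choices G (last_st h')). \<mu>' h' \<alpha> = \<mu> h' \<alpha>))"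

text \<open>
  One iteration with selected history \<open>h\<close> leads from \<open>x\<close> to an optimal solution of the program
  in which the values of \<open>x\<close> outside the prefixes of \<open>h\<close> are frozen.
\<close>

definition improve_N ::
  "('i::finite, 'a) nscsg \<Rightarrow> ('i, 'a) rewards \<Rightarrow> nat \<Rightarrow> 'i state \<Rightarrow> ('i, 'a) run \<Rightarrow>
   ('i, 'a) mixN \<times> ('i, 'a) vals \<Rightarrow> ('i, 'a) mixN \<times> ('i, 'a) vals \<Rightarrow> bool" where
  "improve_N G r K s h x =
     is_arg_max (\<lambda>y. welfare r K s (snd y)) (\<lambda>y. feasible_N G r K s y \<and> keeps_frozen_N G K s h x y)"

definition improve_C ::
  "('i::finite, 'a) nscsg \<Rightarrow> ('i, 'a) rewards \<Rightarrow> nat \<Rightarrow> 'i state \<Rightarrow> ('i, 'a) run \<Rightarrow>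
   ('i, 'a) mixC \<times> ('i, 'a) vals \<Rightarrow> ('i, 'a) mixC \<times> ('i, 'a) vals \<Rightarrow> bool" where
  "improve_C G r K s h x =
     is_arg_max (\<lambda>y. welfare r K s (snd y)) (\<lambda>y. feasible_C G r K s y \<and> keeps_frozen_C G K s h x y)"

text \<open>
  A run of FSI with \<open>m_max\<close> iterations: \<open>x m\<close> is the point and \<open>sel m\<close> the selected history after
  \<open>m\<close> iterations, and \<open>x m_max\<close> is returned.  Equilibria at the initialisation, selected
  histories and optimal solutions are arbitrary.
\<close>

definition FSI_N ::
  "('i::finite, 'a) nscsg \<Rightarrow> ('i, 'a) rewards \<Rightarrow> nat \<Rightarrow> 'i state \<Rightarrow> nat \<Rightarrow>
   (nat \<Rightarrow> ('i, 'a) run) \<Rightarrow> (nat \<Rightarrow> ('i, 'a) mixN \<times> ('i, 'a) vals) \<Rightarrow> bool" where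
  "FSI_N G r K s m_max sel x \<longleftrightarrow>
     init_N G r K s (x 0) \<and>
     (\<forall>m<m_max. sel m \<in> hists_lt_from G K s \<and> improve_N G r K s (sel m) (x m) (x (Suc m)))"

definition FSI_C ::
  "('i::finite, 'a) nscsg \<Rightarrow> ('i, 'a) rewards \<Rightarrow> nat \<Rightarrow> 'i state \<Rightarrow> nat \<Rightarrow>
   (nat \<Rightarrow> ('i, 'a) run) \<Rightarrow> (nat \<Rightarrow> ('i, 'a) mixC \<times> ('i, 'a) vals) \<Rightarrow> bool" where
  "FSI_C G r K s m_max sel x \<longleftrightarrow>
     init_C G r K s (x 0) \<and>
     (\<forall>m<m_max. sel m \<in> hists_lt_from G K s \<and> improve_C G r K s (sel m) (x m) (x (Suc m)))"

text \<open>
  Two runs make the same choices during the first \<open>m\<close> iterations, so that a run with a larger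
  number of iterations continues the one with the smaller number.
\<close>

definition same_choices :: "nat \<Rightarrow> (nat \<Rightarrow> 'h) \<Rightarrow> (nat \<Rightarrow> 'x) \<Rightarrow> (nat \<Rightarrow> 'h) \<Rightarrow> (nat \<Rightarrow> 'x) \<Rightarrow> bool" where
  "same_choices m sel x sel' x' \<longleftrightarrow> (\<forall>k<m. sel' k = sel k) \<and> (\<forall>k\<le>m. x' k = x k)"

end

theory Submission
  imports Defs
begin

text \<open>
  Both constraint systems are local: at each history they say that \<open>\<mu>\<close> is an equilibrium of the
  normal-form game with utilities \<open>Z\<close> and that \<open>V\<close> is its value, which is exactly what backward
  induction produces.  Expected rewards satisfy the same one-stage recursion as \<open>V\<close>, so backward
  induction on histories identifies \<open>V\<close> with the expected rewards, and the absence of profitable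
  one-stage deviations excludes profitable strategy deviations.  An iteration of FSI never decreases
  the welfare because the current point is itself feasible for the frozen program.
\<close>

section \<open>Histories\<close>

lemma stage_extend [simp]: "stage (extend h \<alpha> s') = Suc (stage h)"
  by (simp add: stage_def extend_def)

lemma fst_extend [simp]: "fst (extend h \<alpha> s') = fst h"
  by (simp add: extend_def)

lemma st_extend: "k \<le> stage h \<Longrightarrow> st (extend h \<alpha> s') k = st h k"
  by (cases k) (auto simp: st_def extend_def stage_def nth_append)

lemma act_extend: "k < stage h \<Longrightarrow> act (extend h \<alpha> s') k = act h k"
  by (simp add: act_def extend_def stage_def nth_append)

lemma act_extend_stage: "act (extend h \<alpha> s') (stage h) = \<alpha>"
  by (simp add: act_def extend_def stage_def)

lemma st_extend_Suc: "st (extend h \<alpha> s') (Suc (stage h)) = s'"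
  by (simp add: st_def extend_def stage_def nth_append)

lemma last_st_extend [simp]: "last_st (extend h \<alpha> s') = s'"
  by (simp add: last_st_def st_extend_Suc)

section \<open>Closure and finiteness of the one-step dynamics\<close>

lemma joint_choices_subset_jacts:
  assumes "is_nscsg G" "t \<in> states G"
  shows "joint (choices G t) \<subseteq> jacts G"
proof
  fix \<alpha> assume \<alpha>: "\<alpha> \<in> joint (choices G t)"
  have "\<alpha> i \<in> insert None (Some ` acts G i)" for i
  proof -
    have "avail G i (fst t i) \<subseteq> acts G i"
      using assms by (auto simp: is_nscsg_def states_def)
    moreover have "\<alpha> i \<in> choices G t i"
      using \<alpha> by (simp add: joint_def)
    ultimately show ?thesis
      by (auto simp: choices_def split: if_splits)
  qed
  then show "\<alpha> \<in> jacts G"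
    by (simp add: jacts_def)
qed

lemma finite_choices:
  assumes "is_nscsg G" "t \<in> states G"
  shows "finite (choices G t i)"
proof -
  have "avail G i (fst t i) \<subseteq> acts G i" "finite (acts G i)"
    using assms by (auto simp: is_nscsg_def states_def)
  then show ?thesis
    by (auto simp: choices_def intro: finite_subset)
qed

lemma choices_nonempty: "choices G t i \<noteq> {}"
  by (simp add: choices_def)

lemma joint_eq_PiE: "joint B = PiE UNIV B"
  by (auto simp: joint_def)

lemma finite_joint: "(\<And>i::'i::finite. finite (B i)) \<Longrightarrow> finite (joint B)"
  by (simp add: joint_eq_PiE finite_PiE)

text \<open>Only the locations are random, and they range over the finite sets
  \<open>locs G i\<close>; percepts and the environment state are determined by \<open>t\<close> and
  \<alpha>. Hence the support is finite even when \<open>envs G\<close> is infinite, and expected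
  rewards are finite sums.\<close>

lemma set_pmf_next_state:
  assumes "is_nscsg G" "t \<in> states G" "\<alpha> \<in> jacts G"
  shows "set_pmf (next_state G t \<alpha>) \<subseteq> states G" "finite (set_pmf (next_state G t \<alpha>))"
proof -
  let ?P = "\<lambda>i. loc_trans G i (fst (fst t i), obs G i t) \<alpha>"
  have obs: "obs G i t \<in> pers G i" for i
    using assms by (auto simp: is_nscsg_def)
  have "(fst (fst t i), obs G i t) \<in> lstates G i" for i
  proof -
    have "fst t i \<in> lstates G i" using assms by (simp add: states_def)
    then show ?thesis using obs[of i] by (auto simp: lstates_def mem_Times_iff)
  qed
  then have P: "set_pmf (?P i) \<subseteq> locs G i" for i
    using assms by (simp add: is_nscsg_def)
  have env: "env_trans G (snd t) \<alpha> \<in> envs G"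
    using assms by (simp add: is_nscsg_def states_def)
  have sub: "set_pmf (Pi_pmf UNIV [] ?P) \<subseteq> joint (locs G)"
    using P by (auto simp: set_Pi_pmf PiE_dflt_def joint_def)
  have "finite (joint (locs G))"
    using assms by (intro finite_joint) (simp add: is_nscsg_def)
  then show "finite (set_pmf (next_state G t \<alpha>))"
    using sub by (auto simp: next_state_def intro: finite_subset)
  show "set_pmf (next_state G t \<alpha>) \<subseteq> states G"
  proof
    fix t' assume "t' \<in> set_pmf (next_state G t \<alpha>)"
    then obtain l where "l \<in> joint (locs G)" "t' = (\<lambda>i. (l i, obs G i t), env_trans G (snd t) \<alpha>)"
      using sub unfolding next_state_def set_map_pmf by blast
    then show "t' \<in> states G"
      using obs env by (simp add: states_def lstates_def joint_def)
  qed
qed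

lemma st_in_states:
  assumes "is_nscsg G" "h \<in> hists G" "k \<le> stage h"
  shows "st h k \<in> states G"
  using assms(3)
proof (induction k)
  case 0
  then show ?case using assms(2) by (simp add: hists_def st_def)
next
  case (Suc k)
  then have "st h k \<in> states G" "act h k \<in> joint (choices G (st h k))"
    "st h (Suc k) \<in> set_pmf (next_state G (st h k) (act h k))"
    using assms(2) by (auto simp: hists_def pmf_positive_iff)
  then show ?case
    using set_pmf_next_state(1)[OF assms(1)] joint_choices_subset_jacts[OF assms(1)] by blast
qed

lemma last_st_in_states:
  "is_nscsg G \<Longrightarrow> h \<in> hists G \<Longrightarrow> last_st h \<in> states G"
  by (simp add: last_st_def st_in_states)

lemma finite_choices_last:
  "is_nscsg G \<Longrightarrow> h \<in> hists G \<Longrightarrow> finite (choices G (last_st h) i)"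
  by (simp add: finite_choices last_st_in_states)

lemma finite_joint_choices:
  fixes G :: "('i::finite, 'a) nscsg"
  shows "is_nscsg G \<Longrightarrow> h \<in> hists G \<Longrightarrow> finite (joint (choices G (last_st h)))"
  by (simp add: finite_joint finite_choices_last)

lemma finite_set_pmf_next_state:
  "is_nscsg G \<Longrightarrow> h \<in> hists G \<Longrightarrow> \<alpha> \<in> joint (choices G (last_st h)) \<Longrightarrow>
    finite (set_pmf (next_state G (last_st h) \<alpha>))"
  using set_pmf_next_state(2) joint_choices_subset_jacts last_st_in_states by blast

lemma extend_in_hists:
  assumes "h \<in> hists G" "\<alpha> \<in> joint (choices G (last_st h))"
    "s' \<in> set_pmf (next_state G (last_st h) \<alpha>)"
  shows "extend h \<alpha> s' \<in> hists G"
proof -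
  have "act (extend h \<alpha> s') k \<in> joint (choices G (st (extend h \<alpha> s') k)) \<and>
      pmf (next_state G (st (extend h \<alpha> s') k) (act (extend h \<alpha> s') k)) (st (extend h \<alpha> s') (Suc k)) > 0"
    if "k < Suc (stage h)" for k
  proof (cases "k = stage h")
    case True
    then show ?thesis
      using assms(2,3)
      by (simp add: st_extend act_extend_stage st_extend_Suc pmf_positive_iff flip: last_st_def)
  next
    case False
    then show ?thesis
      using assms(1) that by (simp add: st_extend act_extend hists_def)
  qed
  then show ?thesis
    using assms(1) by (simp add: hists_def)
qed


section \<open>The one-stage recursion of expected rewards\<close>

text \<open>\<open>extend h \<alpha>\<close> is injective, so the histories in
  \<open>succs G h \<alpha>\<close> correspond to the next states of positive probability.\<close>

lemma sum_succs:
  "(\<Sum>h'\<in>succs G h \<alpha>. pmf (next_state G (last_st h) \<alpha>) (last_st h') * f h') =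
    (\<Sum>s'\<in>set_pmf (next_state G (last_st h) \<alpha>). pmf (next_state G (last_st h) \<alpha>) s' * f (extend h \<alpha> s'))"
proof -
  have "succs G h \<alpha> = extend h \<alpha> ` set_pmf (next_state G (last_st h) \<alpha>)"
    by (auto simp: succs_def pmf_positive_iff)
  moreover have "inj_on (extend h \<alpha>) A" for A
    by (auto simp: inj_on_def extend_def)
  ultimately show ?thesis
    by (simp add: sum.reindex)
qed

lemma Z_eq:
  "Z G r K V h i \<alpha> =
     act_rew r i (last_st h) \<alpha> + st_rew r i (last_st h) +
     (\<Sum>s'\<in>set_pmf (next_state G (last_st h) \<alpha>).
        pmf (next_state G (last_st h) \<alpha>) s' * payoff r K V (extend h \<alpha> s') i)"
  unfolding Z_def sum_succs ..

lemma Z_mono: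
  assumes "\<And>s'. s' \<in> set_pmf (next_state G (last_st h) \<alpha>) \<Longrightarrow>
    payoff r K V (extend h \<alpha> s') i \<le> payoff r K W (extend h \<alpha> s') i"
  shows "Z G r K V h i \<alpha> \<le> Z G r K W h i \<alpha>"
  unfolding Z_eq by (intro add_left_mono sum_mono mult_left_mono assms) auto

lemma Z_cong:
  assumes "\<And>s'. s' \<in> set_pmf (next_state G (last_st h) \<alpha>) \<Longrightarrow>
    payoff r K V (extend h \<alpha> s') i = payoff r K W (extend h \<alpha> s') i"
  shows "Z G r K V h i \<alpha> = Z G r K W h i \<alpha>"
  unfolding Z_eq using assms by simp

section \<open>Path distributions and path rewards\<close>

lemma fst_paths: "\<pi> \<in> set_pmf (paths G \<tau> n h) \<Longrightarrow> fst \<pi> = last_st h"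
  by (cases n) auto

text \<open>Generating paths from \<open>h\<close> consults the profile only at \<open>h\<close> and
  its extensions, whose stages are at least \<open>stage h\<close>. In particular, a change at a
  single history does not affect the paths from its proper extensions.\<close>

lemma paths_cong:
  assumes "\<And>h'. stage h \<le> stage h' \<Longrightarrow> \<tau> h' = \<tau>' h'"
  shows "paths G \<tau> n h = paths G \<tau>' n h"
  using assms
proof (induction n arbitrary: h)
  case (Suc n)
  have "paths G \<tau> n (extend h \<alpha> s') = paths G \<tau>' n (extend h \<alpha> s')" for \<alpha> s'
    by (rule Suc.IH) (simp add: Suc.prems)
  with Suc.prems[of h] show ?case by simp
qed simp

text \<open>The bound on \<open>stage h + n\<close> ensures that \<tau> is consulted only before
  stage \<open>K\<close>, where membership in \<open>cprofiles G K\<close> confines its support to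
  the finite set of available joint actions.\<close>

lemma finite_paths:
  fixes G :: "('i::finite, 'a) nscsg"
  assumes "is_nscsg G" "\<tau> \<in> cprofiles G K" "h \<in> hists G" "stage h + n \<le> K"
  shows "finite (set_pmf (paths G \<tau> n h))"
  using assms(3,4)
proof (induction n arbitrary: h)
  case (Suc n)
  have sub: "set_pmf (\<tau> h) \<subseteq> joint (choices G (last_st h))"
    using assms(2) Suc.prems unfolding cprofiles_def hists_lt_def by fastforce
  have "finite (set_pmf (\<tau> h))"
    using sub finite_joint_choices[OF assms(1) Suc.prems(1)] by (rule finite_subset)
  moreover have "finite (set_pmf (next_state G (last_st h) \<alpha>))" if "\<alpha> \<in> set_pmf (\<tau> h)" for \<alpha>
    using that sub finite_set_pmf_next_state[OF assms(1) Suc.prems(1)] by blast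
  moreover have "finite (set_pmf (paths G \<tau> n (extend h \<alpha> s')))"
    if "\<alpha> \<in> set_pmf (\<tau> h)" "s' \<in> set_pmf (next_state G (last_st h) \<alpha>)" for \<alpha> s'
  proof (rule Suc.IH)
    show "extend h \<alpha> s' \<in> hists G"
      using that sub Suc.prems(1) by (intro extend_in_hists) auto
  qed (use Suc.prems in simp)
  ultimately show ?case
    by auto
qed simp

lemma path_reward_Cons:
  "path_reward r i (t, (\<alpha>, s') # p) =
    act_rew r i t \<alpha> + st_rew r i t + path_reward r i (s', p)"
  by (simp add: path_reward_def stage_def last_st_def st_def act_def sum.lessThan_Suc_shift
      del: sum.lessThan_Suc)

lemma expected_reward_final:
  "stage h = K \<Longrightarrow> expected_reward G r K \<tau> i h = st_rew r i (last_st h)"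
  by (simp add: expected_reward_def path_reward_def stage_def last_st_def st_def)

text \<open>Expected rewards already have the prescribed terminal values at stage \<open>K\<close>,
  so they can take the place of the variables \<open>V\<close> in \<open>Z\<close>.\<close>

lemma payoff_expected_reward [simp]:
  "payoff r K (\<lambda>h i. expected_reward G r K \<tau> i h) h i = expected_reward G r K \<tau> i h"
  by (simp add: payoff_def expected_reward_final)

text \<open>Law of total expectation over the first joint action and the first next state. The
  result has the shape of the value equation of the programs, with expected rewards in the role of
  \<open>V\<close>, and so links the programs to the game.\<close>

lemma expected_reward_rec:
  fixes G :: "('i::finite, 'a) nscsg"
  assumes G: "is_nscsg G" and \<tau>: "\<tau> \<in> cprofiles G K" and h: "h \<in> hists_lt G K"
  shows "expected_reward G r K \<tau> i h =
    corr_utility (choices G (last_st h)) (Z G r K (\<lambda>h i. expected_reward G r K \<tau> i h) h i) (pmf (\<tau> h))"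
proof -
  \<comment> \<open>\<open>n\<close> counts the steps left after the first one. It equals
    \<open>K - stage\<close> at each one-step extension of \<open>h\<close>, which lets
    \<open>expected_reward\<close> be recognised there.\<close>
  define n where "n = K - Suc (stage h)"
  have n: "K - stage h = Suc n" "stage h + Suc n = K" and hh: "h \<in> hists G"
    using h by (auto simp: hists_lt_def n_def)
  let ?J = "joint (choices G (last_st h))"
  let ?next = "next_state G (last_st h)"
  define c where "c \<alpha> = act_rew r i (last_st h) \<alpha> + st_rew r i (last_st h)" for \<alpha>
  \<comment> \<open>\<open>Q \<alpha> s'\<close> is the law of the whole path from \<open>h\<close>,
    given that its first step is \<open>(\<alpha>, s')\<close>.\<close>
  define Q where "Q \<alpha> s' = map_pmf (\<lambda>\<pi>. (last_st h, (\<alpha>, s') # snd \<pi>)) (paths G \<tau> n (extend h \<alpha> s'))"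
    for \<alpha> s'
  have sub: "set_pmf (\<tau> h) \<subseteq> ?J"
    using \<tau> h by (simp add: cprofiles_def)
  have finJ: "finite ?J"
    using G hh by (rule finite_joint_choices)
  have finN: "finite (set_pmf (?next \<alpha>))" if "\<alpha> \<in> ?J" for \<alpha>
    using G hh that by (rule finite_set_pmf_next_state)
  have finP: "finite (set_pmf (paths G \<tau> n (extend h \<alpha> s')))"
    if "\<alpha> \<in> ?J" "s' \<in> set_pmf (?next \<alpha>)" for \<alpha> s'
    using n by (intro finite_paths[OF G \<tau>] extend_in_hists hh that) simp
  have EQ: "measure_pmf.expectation (Q \<alpha> s') (path_reward r i) =
      c \<alpha> + expected_reward G r K \<tau> i (extend h \<alpha> s')"
    if "\<alpha> \<in> ?J" "s' \<in> set_pmf (?next \<alpha>)" for \<alpha> s'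
  proof -
    let ?p = "paths G \<tau> n (extend h \<alpha> s')"
    have "measure_pmf.expectation (Q \<alpha> s') (path_reward r i) =
        measure_pmf.expectation ?p (\<lambda>\<pi>. path_reward r i (last_st h, (\<alpha>, s') # snd \<pi>))"
      by (simp add: Q_def)
    also have "\<dots> = measure_pmf.expectation ?p (\<lambda>\<pi>. c \<alpha> + path_reward r i \<pi>)"
    \<comment> \<open>The equation relies on the path starting in \<open>s'\<close>; by
      \<open>fst_paths\<close> such paths carry all the mass, hence equality almost
      everywhere.\<close>
    proof (intro integral_cong_AE)
      have "path_reward r i (last_st h, (\<alpha>, s') # snd \<pi>) = c \<alpha> + path_reward r i \<pi>"
        if "\<pi> \<in> set_pmf ?p" for \<pi>
        using fst_paths[OF that] by (cases \<pi>) (simp add: path_reward_Cons c_def)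
      then show "AE \<pi> in measure_pmf ?p.
          path_reward r i (last_st h, (\<alpha>, s') # snd \<pi>) = c \<alpha> + path_reward r i \<pi>"
        by (simp add: AE_measure_pmf_iff)
    qed simp_all
    also have "\<dots> = c \<alpha> + measure_pmf.expectation ?p (path_reward r i)"
      by (subst Bochner_Integration.integral_add)
        (auto intro: integrable_measure_pmf_finite[OF finP[OF that]])
    also have "measure_pmf.expectation ?p (path_reward r i) =
        expected_reward G r K \<tau> i (extend h \<alpha> s')"
      by (simp add: expected_reward_def n_def)
    finally show ?thesis .
  qed
  have EN: "measure_pmf.expectation (bind_pmf (?next \<alpha>) (Q \<alpha>)) (path_reward r i) =
      Z G r K (\<lambda>h i. expected_reward G r K \<tau> i h) h i \<alpha>" if \<alpha>: "\<alpha> \<in> ?J" for \<alpha>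
  proof -
    have "measure_pmf.expectation (bind_pmf (?next \<alpha>) (Q \<alpha>)) (path_reward r i) =
        (\<Sum>s'\<in>set_pmf (?next \<alpha>). pmf (?next \<alpha>) s' *\<^sub>R
          measure_pmf.expectation (Q \<alpha> s') (path_reward r i))"
      by (rule pmf_expectation_bind) (use finN finP \<alpha> in \<open>auto simp: Q_def\<close>)
    also have "\<dots> = (\<Sum>s'\<in>set_pmf (?next \<alpha>). pmf (?next \<alpha>) s' * c \<alpha> +
          pmf (?next \<alpha>) s' * expected_reward G r K \<tau> i (extend h \<alpha> s'))"
      using EQ \<alpha> by (intro sum.cong) (auto simp: algebra_simps)
    also have "\<dots> = Z G r K (\<lambda>h i. expected_reward G r K \<tau> i h) h i \<alpha>"
      \<comment> \<open>The probabilities of the next states add up to 1, which turns the first part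
        of the sum into \<open>c \<alpha>\<close>.\<close>
      by (simp add: sum.distrib Z_eq c_def finN[OF \<alpha>] sum_pmf_eq_1 flip: sum_distrib_right)
    finally show ?thesis .
  qed
  have "expected_reward G r K \<tau> i h =
      measure_pmf.expectation (bind_pmf (\<tau> h) (\<lambda>\<alpha>. bind_pmf (?next \<alpha>) (Q \<alpha>))) (path_reward r i)"
    by (simp add: expected_reward_def n Q_def[abs_def])
  also have "\<dots> = (\<Sum>\<alpha>\<in>?J. pmf (\<tau> h) \<alpha> *\<^sub>R
      measure_pmf.expectation (bind_pmf (?next \<alpha>) (Q \<alpha>)) (path_reward r i))"
  proof (rule pmf_expectation_bind[OF finJ _ sub])
    fix \<alpha> assume "\<alpha> \<in> ?J"
    then show "finite (set_pmf (bind_pmf (?next \<alpha>) (Q \<alpha>)))"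
      using finN finP by (auto simp: Q_def)
  qed
  also have "\<dots> = corr_utility (choices G (last_st h))
      (Z G r K (\<lambda>h i. expected_reward G r K \<tau> i h) h i) (pmf (\<tau> h))"
    unfolding corr_utility_def by (intro sum.cong) (auto simp: EN)
  finally show ?thesis .
qed

section \<open>Backward induction on histories\<close>

lemma corr_utility_mono:
  assumes "\<And>\<alpha>. \<alpha> \<in> joint B \<Longrightarrow> 0 \<le> p \<alpha>" "\<And>\<alpha>. \<alpha> \<in> joint B \<Longrightarrow> u \<alpha> \<le> v \<alpha>"
  shows "corr_utility B u p \<le> corr_utility B v p"
  unfolding corr_utility_def by (intro sum_mono mult_left_mono assms)

text \<open>Induction on the number \<open>K - stage h\<close> of remaining stages. The hypothesis
  of a step covers the successors that \<open>Z\<close> sums over for available joint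
  actions.\<close>

lemma hists_from_backward_induct [consumes 3, case_names final step]:
  fixes G :: "('i::finite, 'a) nscsg"
  assumes "h \<in> hists G" "fst h = s" "stage h \<le> K"
    and "\<And>h. h \<in> hists G \<Longrightarrow> fst h = s \<Longrightarrow> stage h = K \<Longrightarrow> P h"
    and step: "\<And>h. h \<in> hists_lt_from G K s \<Longrightarrow>
      (\<And>\<alpha> s'. \<alpha> \<in> joint (choices G (last_st h)) \<Longrightarrow>
        s' \<in> set_pmf (next_state G (last_st h) \<alpha>) \<Longrightarrow> P (extend h \<alpha> s')) \<Longrightarrow> P h"
  shows "P h"
  using assms(1-3)
proof (induction "K - stage h" arbitrary: h)
  case 0
  then show ?case using assms(4) by simp
next
  case (Suc n)
  show ?case
  proof (rule step)
    show "h \<in> hists_lt_from G K s"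
      using Suc by (simp add: hists_lt_from_def hists_lt_def)
  next
    fix \<alpha> s' assume "\<alpha> \<in> joint (choices G (last_st h))" "s' \<in> set_pmf (next_state G (last_st h) \<alpha>)"
    then show "P (extend h \<alpha> s')"
      using Suc by (intro Suc.hyps(1)) (auto intro: extend_in_hists)
  qed
qed

text \<open>The core of the one-shot deviation principle: \<tau> will be a profile in which one
  agent deviates at arbitrarily many histories, while \<open>V\<close> is tested one stage at a
  time. The recursion is monotone in the later values, so the local inequalities propagate backwards
  from stage \<open>K\<close>.\<close>

lemma payoff_ge_expected_reward:
  fixes G :: "('i::finite, 'a) nscsg"
  assumes G: "is_nscsg G" and \<tau>: "\<tau> \<in> cprofiles G K"
    and V: "\<And>h. h \<in> hists_lt_from G K s \<Longrightarrow>
      corr_utility (choices G (last_st h)) (Z G r K V h i) (pmf (\<tau> h)) \<le> V h i"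
    and "h \<in> hists G" "fst h = s" "stage h \<le> K"
  shows "expected_reward G r K \<tau> i h \<le> payoff r K V h i"
  using assms(4-6)
proof (induction rule: hists_from_backward_induct)
  case (final h)
  then show ?case by (simp add: expected_reward_final payoff_def)
next
  case (step h)
  then have h: "h \<in> hists_lt G K" "stage h \<noteq> K"
    by (auto simp: hists_lt_from_def hists_lt_def)
  have "expected_reward G r K \<tau> i h \<le>
      corr_utility (choices G (last_st h)) (Z G r K V h i) (pmf (\<tau> h))"
    unfolding expected_reward_rec[OF G \<tau> h(1)]
    by (intro corr_utility_mono Z_mono) (use step.IH in auto)
  then show ?case
    using V[OF step.hyps] h(2) by (simp add: payoff_def)
qed

text \<open>With the terminal values fixed, the one-stage recursion has only one solution, and the
  expected rewards solve it by \<open>expected_reward_rec\<close>.\<close>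

lemma payoff_eq_expected_reward:
  fixes G :: "('i::finite, 'a) nscsg"
  assumes G: "is_nscsg G" and \<tau>: "\<tau> \<in> cprofiles G K"
    and V: "\<And>h. h \<in> hists_lt_from G K s \<Longrightarrow>
      V h i = corr_utility (choices G (last_st h)) (Z G r K V h i) (pmf (\<tau> h))"
    and "h \<in> hists G" "fst h = s" "stage h \<le> K"
  shows "payoff r K V h i = expected_reward G r K \<tau> i h"
  using assms(4-6)
proof (induction rule: hists_from_backward_induct)
  case (final h)
  then show ?case by (simp add: expected_reward_final payoff_def)
next
  case (step h)
  then have h: "h \<in> hists_lt G K" "stage h \<noteq> K"
    by (auto simp: hists_lt_from_def hists_lt_def)
  have "Z G r K V h i \<alpha> = Z G r K (\<lambda>h i. expected_reward G r K \<tau> i h) h i \<alpha>"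
    if "\<alpha> \<in> joint (choices G (last_st h))" for \<alpha>
    using step.IH that by (intro Z_cong) simp
  then have "expected_reward G r K \<tau> i h =
      corr_utility (choices G (last_st h)) (Z G r K V h i) (pmf (\<tau> h))"
    unfolding expected_reward_rec[OF G \<tau> h(1)] corr_utility_def by simp
  then show ?case
    using V[OF step.hyps] h(2) by (simp add: payoff_def)
qed


section \<open>Local equilibria are subgame-perfect\<close>

text \<open>Elements of \<open>prob_vecs B\<close> are unconstrained outside \<open>B\<close>, so
  the mass function is cut off to 0 there before it is embedded.\<close>

lemma prob_vec_pmf:
  assumes "finite B" "x \<in> prob_vecs B"
  obtains q where "set_pmf q \<subseteq> B" "\<And>b. b \<in> B \<Longrightarrow> pmf q b = x b"
proof -
  let ?f = "\<lambda>b. if b \<in> B then x b else 0"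
  have nn: "0 \<le> ?f b" for b
    using assms(2) by (simp add: prob_vecs_def)
  have "(\<integral>\<^sup>+b. ennreal (?f b) \<partial>count_space UNIV) = (\<Sum>b\<in>B. ennreal (?f b))"
    by (rule nn_integral_count_space'[OF assms(1)]) auto
  also have "\<dots> = ennreal (\<Sum>b\<in>B. ?f b)"
    using nn by (rule sum_ennreal)
  also have "\<dots> = 1"
    using assms(2) by (simp add: prob_vecs_def)
  finally have *: "pmf (embed_pmf ?f) b = ?f b" for b
    using nn by (intro pmf_embed_pmf)
  show ?thesis
  proof (rule that)
    show "set_pmf (embed_pmf ?f) \<subseteq> B"
    proof
      fix b assume "b \<in> set_pmf (embed_pmf ?f)"
      then have "?f b \<noteq> 0" by (simp only: set_pmf_iff *) simp
      then show "b \<in> B" by (simp split: if_splits)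
    qed
    show "pmf (embed_pmf ?f) b = x b" if "b \<in> B" for b
      using that by (simp only: *) simp
  qed
qed

lemma pmf_prob_vecs:
  assumes "finite B" "set_pmf q \<subseteq> B"
  shows "pmf q \<in> prob_vecs B"
  using assms by (simp add: prob_vecs_def sum_pmf_eq_1)

text \<open>Independent play is correlated play with a product distribution, so both equilibrium
  types can use the results on correlated profiles.\<close>

lemma mixed_utility_eq_corr_utility:
  "mixed_utility B u x = corr_utility B u (\<lambda>\<alpha>. \<Prod>i\<in>UNIV. x i (\<alpha> i))"
  by (simp add: mixed_utility_def corr_utility_def)

lemma pmf_indep: "pmf (indep \<sigma> h) \<alpha> = (\<Prod>i\<in>UNIV. pmf (\<sigma> i h) (\<alpha> i))"
  by (simp add: indep_def pmf_Pi)

lemma mixed_utility_cong: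
  assumes "\<And>i a. a \<in> B i \<Longrightarrow> x i a = y i a"
  shows "mixed_utility B u x = mixed_utility B u y"
proof -
  have "(\<Prod>i\<in>UNIV. x i (\<alpha> i)) = (\<Prod>i\<in>UNIV. y i (\<alpha> i))" if "\<alpha> \<in> joint B" for \<alpha>
    using that assms by (intro prod.cong) (auto simp: joint_def)
  then show ?thesis
    by (simp add: mixed_utility_def)
qed

lemma corr_utility_indep:
  "corr_utility B u (pmf (indep \<sigma> h)) = mixed_utility B u (\<lambda>i. pmf (\<sigma> i h))"
  by (simp add: mixed_utility_eq_corr_utility pmf_indep[abs_def])

lemma indep_in_cprofiles:
  "(\<And>i. \<sigma> i \<in> strategies G K i) \<Longrightarrow> indep \<sigma> \<in> cprofiles G K"
  by (fastforce simp: strategies_def cprofiles_def indep_def joint_def set_Pi_pmf PiE_dflt_def)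

text \<open>The local Nash distributions are assembled into strategies \<sigma>. Since
  \<open>V\<close> solves the recursion of \<open>indep \<sigma>\<close>, it is its expected reward;
  since no agent can improve on \<open>V\<close> at a single stage, no strategy deviation exceeds
  \<open>V\<close> either.\<close>

lemma init_N_SPNE_with_payoffs:
  fixes G :: "('i::finite, 'a) nscsg"
  assumes G: "is_nscsg G" and init: "init_N G r K s (\<mu>, V)"
  shows "SPNE_with_payoffs G r K s (\<mu>, V)"
proof -
  have histsD: "h \<in> hists G" "fst h = s" "stage h \<le> K" "h \<in> hists_lt G K" "stage h \<noteq> K"
    if "h \<in> hists_lt_from G K s" for h
    using that by (auto simp: hists_lt_from_def hists_lt_def)
  have fin: "finite (choices G (last_st h) i)" if "h \<in> hists_lt_from G K s" for h i
    using finite_choices_last[OF G] histsD(1)[OF that] by blast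
  have nash: "nash_eq (choices G (last_st h)) (Z G r K V h) (\<mu> h)"
    and val: "V h i = mixed_utility (choices G (last_st h)) (Z G r K V h i) (\<mu> h)"
    if "h \<in> hists_lt_from G K s" for h i
    using init that by (auto simp: init_N_def)
  \<comment> \<open>The strategy must be admissible at histories from other initial states too,
    where \<mu> is not constrained; a point mass on an available action serves there.\<close>
  have "\<exists>q. set_pmf q \<subseteq> choices G (last_st h) i \<and>
      (h \<in> hists_lt_from G K s \<longrightarrow> (\<forall>a\<in>choices G (last_st h) i. pmf q a = \<mu> h i a))" for h i
  proof (cases "h \<in> hists_lt_from G K s")
    case True
    then have "\<mu> h i \<in> prob_vecs (choices G (last_st h) i)"
      using nash by (auto simp: nash_eq_def)
    with fin[OF True] show ?thesis
      by (metis prob_vec_pmf)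
  next
    case False
    obtain a where "a \<in> choices G (last_st h) i"
      using choices_nonempty[of G "last_st h" i] by blast
    with False show ?thesis
      by (intro exI[of _ "return_pmf a"]) simp
  qed
  then have "\<exists>\<sigma>. \<forall>i h. set_pmf (\<sigma> i h) \<subseteq> choices G (last_st h) i \<and>
      (h \<in> hists_lt_from G K s \<longrightarrow> (\<forall>a\<in>choices G (last_st h) i. pmf (\<sigma> i h) a = \<mu> h i a))"
    by (intro choice allI)
  then obtain \<sigma> where \<sigma>: "\<And>i h. set_pmf (\<sigma> i h) \<subseteq> choices G (last_st h) i"
    and pmf_\<sigma>: "\<And>i h a. h \<in> hists_lt_from G K s \<Longrightarrow> a \<in> choices G (last_st h) i \<Longrightarrow>
      pmf (\<sigma> i h) a = \<mu> h i a"
    by blast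
  have strat: "\<sigma> i \<in> strategies G K i" for i
    using \<sigma> by (simp add: strategies_def)
  have V_eq: "V h i = expected_reward G r K (indep \<sigma>) i h" if h: "h \<in> hists_lt_from G K s" for h i
  proof -
    have "payoff r K V h i = expected_reward G r K (indep \<sigma>) i h"
    proof (rule payoff_eq_expected_reward[OF G indep_in_cprofiles[OF strat]])
      fix h assume h: "h \<in> hists_lt_from G K s"
      show "V h i = corr_utility (choices G (last_st h)) (Z G r K V h i) (pmf (indep \<sigma> h))"
        unfolding val[OF h] corr_utility_indep
        by (rule mixed_utility_cong) (simp add: pmf_\<sigma>[OF h])
    qed (use histsD[OF h] in auto)
    then show ?thesis
      using histsD[OF h] by (simp add: payoff_def)
  qed
  have "expected_reward G r K (indep (\<sigma>(i := \<sigma>'))) i h \<le> expected_reward G r K (indep \<sigma>) i h"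
    if \<sigma>': "\<sigma>' \<in> strategies G K i" and h: "h \<in> hists_lt_from G K s" for i \<sigma>' h
  proof -
    have "expected_reward G r K (indep (\<sigma>(i := \<sigma>'))) i h \<le> payoff r K V h i"
    proof (rule payoff_ge_expected_reward[OF G])
      show "indep (\<sigma>(i := \<sigma>')) \<in> cprofiles G K"
        using strat \<sigma>' by (intro indep_in_cprofiles) simp
    next
      fix h assume h: "h \<in> hists_lt_from G K s"
      let ?B = "choices G (last_st h)"
      have "set_pmf (\<sigma>' h) \<subseteq> ?B i"
        using \<sigma>' histsD(4)[OF h] by (simp add: strategies_def)
      then have "pmf (\<sigma>' h) \<in> prob_vecs (?B i)"
        by (rule pmf_prob_vecs[OF fin[OF h]])
      \<comment> \<open>At a single stage the deviating strategy is one mixed action against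
        \<open>\<mu> h\<close>, with later payoffs still given by \<open>V\<close>, so the local
        Nash condition applies.\<close>
      then have "mixed_utility ?B (Z G r K V h i) ((\<mu> h)(i := pmf (\<sigma>' h))) \<le> V h i"
        using nash[OF h] by (simp add: nash_eq_def val[OF h])
      moreover have "mixed_utility ?B (Z G r K V h i) ((\<mu> h)(i := pmf (\<sigma>' h))) =
          corr_utility ?B (Z G r K V h i) (pmf (indep (\<sigma>(i := \<sigma>')) h))"
        unfolding corr_utility_indep by (rule mixed_utility_cong) (simp add: pmf_\<sigma>[OF h])
      ultimately show "corr_utility ?B (Z G r K V h i) (pmf (indep (\<sigma>(i := \<sigma>')) h)) \<le> V h i"
        by simp
    qed (use histsD[OF h] in auto)
    then show ?thesis
      using histsD[OF h] V_eq[OF h] by (simp add: payoff_def)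
  qed
  then have "is_SPNE G r K s \<sigma>"
    using strat by (simp add: is_SPNE_def)
  then show ?thesis
    using pmf_\<sigma> V_eq by (auto simp: SPNE_with_payoffs_def)
qed

text \<open>Conditioning on the recommendation divides the mass by its probability, and the
  replacement of \<open>a\<close> by \<open>a'\<close> moves into the argument of the utility. The
  sum thus stays over the recommended joint actions, as in \<open>corr_eq\<close>.\<close>

lemma sum_deviation:
  fixes q :: "('i::finite \<Rightarrow> 'b) pmf"
  assumes fin: "\<And>i. finite (B i)" and q: "set_pmf q \<subseteq> joint B" and a': "a' \<in> B i"
    and pos: "measure_pmf.prob q {\<alpha>. \<alpha> i = a} > 0"
  shows "corr_utility B u (pmf (map_pmf (\<lambda>\<alpha>. \<alpha>(i := a')) (cond_pmf q {\<alpha>. \<alpha> i = a}))) =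
    (\<Sum>\<alpha>\<in>{\<alpha>\<in>joint B. \<alpha> i = a}. pmf q \<alpha> * u (\<alpha>(i := a'))) / measure_pmf.prob q {\<alpha>. \<alpha> i = a}"
    and "set_pmf (map_pmf (\<lambda>\<alpha>. \<alpha>(i := a')) (cond_pmf q {\<alpha>. \<alpha> i = a})) \<subseteq> joint B"
proof -
  let ?A = "{\<alpha>. \<alpha> i = a}"
  let ?c = "cond_pmf q ?A"
  let ?m = "map_pmf (\<lambda>\<alpha>. \<alpha>(i := a')) ?c"
  have ne: "set_pmf q \<inter> ?A \<noteq> {}"
    using pos by (metis measure_pmf_zero_iff less_irrefl)
  have fJ: "finite (joint B)"
    using fin by (rule finite_joint)
  have sc: "set_pmf ?c \<subseteq> {\<alpha>\<in>joint B. \<alpha> i = a}"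
    using q ne by (auto simp: set_cond_pmf)
  show sm: "set_pmf ?m \<subseteq> joint B"
    using sc a' by (auto simp: joint_def)
  have "corr_utility B u (pmf ?m) = measure_pmf.expectation ?m u"
    unfolding corr_utility_def using sm
    by (subst integral_measure_pmf_real[OF fJ]) (auto intro: sum.cong)
  also have "\<dots> = measure_pmf.expectation ?c (\<lambda>\<alpha>. u (\<alpha>(i := a')))"
    by simp
  also have "\<dots> = (\<Sum>\<alpha>\<in>{\<alpha>\<in>joint B. \<alpha> i = a}. u (\<alpha>(i := a')) * pmf ?c \<alpha>)"
    using sc fJ by (intro integral_measure_pmf_real) auto
  also have "\<dots> = (\<Sum>\<alpha>\<in>{\<alpha>\<in>joint B. \<alpha> i = a}. pmf q \<alpha> * u (\<alpha>(i := a')) / measure_pmf.prob q ?A)"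
    by (intro sum.cong) (auto simp: pmf_cond[OF ne])
  finally show "corr_utility B u (pmf ?m) =
      (\<Sum>\<alpha>\<in>{\<alpha>\<in>joint B. \<alpha> i = a}. pmf q \<alpha> * u (\<alpha>(i := a'))) / measure_pmf.prob q ?A"
    by (simp add: sum_divide_distrib)
qed

text \<open>The first stage is governed by the changed distribution at \<open>h\<close>, which
  \<open>sum_deviation\<close> evaluates; all later stages are governed by \<tau>.\<close>

lemma expected_reward_deviate:
  fixes G :: "('i::finite, 'a) nscsg"
  assumes G: "is_nscsg G" and \<tau>: "\<tau> \<in> cprofiles G K" and h: "h \<in> hists_lt G K"
    and a': "a' \<in> choices G (last_st h) i"
    and pos: "measure_pmf.prob (\<tau> h) {\<alpha>. \<alpha> i = a} > 0"
  shows "expected_reward G r K (deviate \<tau> i a a' h) i h =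
    (\<Sum>\<alpha>\<in>{\<alpha>\<in>joint (choices G (last_st h)). \<alpha> i = a}.
      pmf (\<tau> h) \<alpha> * Z G r K (\<lambda>h i. expected_reward G r K \<tau> i h) h i (\<alpha>(i := a'))) /
    measure_pmf.prob (\<tau> h) {\<alpha>. \<alpha> i = a}"
proof -
  let ?\<tau>' = "deviate \<tau> i a a' h"
  have fin: "finite (choices G (last_st h) j)" for j
    using h by (intro finite_choices_last[OF G]) (simp add: hists_lt_def)
  have sub: "set_pmf (\<tau> h) \<subseteq> joint (choices G (last_st h))"
    using \<tau> h by (simp add: cprofiles_def)
  note dev = sum_deviation[OF fin sub a' pos]
  have "?\<tau>' \<in> cprofiles G K"
    using \<tau> dev(2) by (auto simp: cprofiles_def deviate_def)
  from expected_reward_rec[OF G this h]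
  have "expected_reward G r K ?\<tau>' i h = corr_utility (choices G (last_st h))
      (Z G r K (\<lambda>h i. expected_reward G r K ?\<tau>' i h) h i) (pmf (?\<tau>' h))" .
  also have "Z G r K (\<lambda>h i. expected_reward G r K ?\<tau>' i h) h i =
      Z G r K (\<lambda>h i. expected_reward G r K \<tau> i h) h i"
  \<comment> \<open>The successors of \<open>h\<close> lie at later stages, and from there on the
    two profiles agree.\<close>
  proof (intro ext Z_cong)
    fix \<alpha> s'
    have "paths G ?\<tau>' n (extend h \<alpha> s') = paths G \<tau> n (extend h \<alpha> s')" for n
      by (rule paths_cong) (auto simp: deviate_def)
    then show "payoff r K (\<lambda>h i. expected_reward G r K ?\<tau>' i h) (extend h \<alpha> s') i =
        payoff r K (\<lambda>h i. expected_reward G r K \<tau> i h) (extend h \<alpha> s') i"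
      by (simp only: payoff_expected_reward) (simp only: expected_reward_def)
  qed
  also have "?\<tau>' h = map_pmf (\<lambda>\<alpha>. \<alpha>(i := a')) (cond_pmf (\<tau> h) {\<alpha>. \<alpha> i = a})"
    by (simp add: deviate_def)
  finally show ?thesis
    by (simp only: dev(1))
qed

text \<open>A deviation concerns one history and its continuation values equal \<open>V\<close>, so
  the equilibrium inequality at \<open>h\<close> is the local one divided by the probability of the
  recommendation.\<close>

lemma init_C_SPCE_with_payoffs:
  fixes G :: "('i::finite, 'a) nscsg"
  assumes G: "is_nscsg G" and init: "init_C G r K s (\<mu>, V)"
  shows "SPCE_with_payoffs G r K s (\<mu>, V)"
proof -
  have histsD: "h \<in> hists G" "fst h = s" "stage h \<le> K" "h \<in> hists_lt G K" "stage h \<noteq> K"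
    if "h \<in> hists_lt_from G K s" for h
    using that by (auto simp: hists_lt_from_def hists_lt_def)
  have ce: "corr_eq (choices G (last_st h)) (Z G r K V h) (\<mu> h)"
    and val: "V h i = corr_utility (choices G (last_st h)) (Z G r K V h i) (\<mu> h)"
    if "h \<in> hists_lt_from G K s" for h i
    using init that by (auto simp: init_C_def)
  have "\<exists>q. set_pmf q \<subseteq> joint (choices G (last_st h)) \<and>
      (h \<in> hists_lt_from G K s \<longrightarrow> (\<forall>\<alpha>\<in>joint (choices G (last_st h)). pmf q \<alpha> = \<mu> h \<alpha>))" for h
  proof (cases "h \<in> hists_lt_from G K s")
    case True
    then have "\<mu> h \<in> prob_vecs (joint (choices G (last_st h)))"
      using ce by (auto simp: corr_eq_def)
    with finite_joint_choices[OF G histsD(1)[OF True]] show ?thesis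
      by (metis prob_vec_pmf)
  next
    case False
    have "\<exists>\<alpha>. \<forall>i. \<alpha> i \<in> choices G (last_st h) i"
      using choices_nonempty[of G "last_st h"] by (intro choice) blast
    then obtain \<alpha> where "\<And>i. \<alpha> i \<in> choices G (last_st h) i"
      by blast
    with False show ?thesis
      by (intro exI[of _ "return_pmf \<alpha>"]) (simp add: joint_def)
  qed
  then have "\<exists>\<tau>. \<forall>h. set_pmf (\<tau> h) \<subseteq> joint (choices G (last_st h)) \<and>
      (h \<in> hists_lt_from G K s \<longrightarrow> (\<forall>\<alpha>\<in>joint (choices G (last_st h)). pmf (\<tau> h) \<alpha> = \<mu> h \<alpha>))"
    by (intro choice allI)
  then obtain \<tau> where \<tau>: "\<And>h. set_pmf (\<tau> h) \<subseteq> joint (choices G (last_st h))"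
    and pmf_\<tau>: "\<And>h \<alpha>. h \<in> hists_lt_from G K s \<Longrightarrow> \<alpha> \<in> joint (choices G (last_st h)) \<Longrightarrow>
      pmf (\<tau> h) \<alpha> = \<mu> h \<alpha>"
    by blast
  have prof: "\<tau> \<in> cprofiles G K"
    using \<tau> by (simp add: cprofiles_def)
  \<comment> \<open>Histories of stage \<open>K\<close> are included because they occur as
    successors in \<open>Z\<close> at the last stage before the end.\<close>
  have payoff_eq: "payoff r K V h i = expected_reward G r K \<tau> i h"
    if "h \<in> hists G" "fst h = s" "stage h \<le> K" for h i
  proof (rule payoff_eq_expected_reward[OF G prof _ that])
    fix h assume h: "h \<in> hists_lt_from G K s"
    show "V h i = corr_utility (choices G (last_st h)) (Z G r K V h i) (pmf (\<tau> h))"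
      unfolding val[OF h] corr_utility_def using pmf_\<tau>[OF h] by simp
  qed
  have V_eq: "V h i = expected_reward G r K \<tau> i h" if "h \<in> hists_lt_from G K s" for h i
    using payoff_eq[of h i] histsD[OF that] by (simp add: payoff_def)
  have "expected_reward G r K (deviate \<tau> i a a' h) i h \<le> expected_reward G r K (deviate \<tau> i a a h) i h"
    if h: "h \<in> hists_lt_from G K s" and a: "a \<in> choices G (last_st h) i"
      and a': "a' \<in> choices G (last_st h) i" and pos: "measure_pmf.prob (\<tau> h) {\<alpha>. \<alpha> i = a} > 0"
    for i h a a'
  proof -
    let ?J = "joint (choices G (last_st h))"
    let ?E = "\<lambda>h i. expected_reward G r K \<tau> i h"
    have Z: "Z G r K ?E h i \<alpha> = Z G r K V h i \<alpha>" if "\<alpha> \<in> ?J" for \<alpha>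
    proof (rule Z_cong)
      fix s' assume "s' \<in> set_pmf (next_state G (last_st h) \<alpha>)"
      then have "extend h \<alpha> s' \<in> hists G"
        using histsD[OF h] that by (intro extend_in_hists)
      then show "payoff r K ?E (extend h \<alpha> s') i = payoff r K V (extend h \<alpha> s') i"
        using histsD[OF h] by (simp add: payoff_eq)
    qed
    \<comment> \<open>Obeying is the case \<open>b = a\<close>, so both sides of the comparison have
      this form with the same denominator.\<close>
    have eq: "expected_reward G r K (deviate \<tau> i a b h) i h =
        (\<Sum>\<alpha>\<in>{\<alpha>\<in>?J. \<alpha> i = a}. \<mu> h \<alpha> * Z G r K V h i (\<alpha>(i := b))) /
        measure_pmf.prob (\<tau> h) {\<alpha>. \<alpha> i = a}" if b: "b \<in> choices G (last_st h) i" for b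
    proof -
      have "\<alpha>(i := b) \<in> ?J" if "\<alpha> \<in> ?J" for \<alpha>
        using that b by (simp add: joint_def)
      then have "(\<Sum>\<alpha>\<in>{\<alpha>\<in>?J. \<alpha> i = a}. pmf (\<tau> h) \<alpha> * Z G r K ?E h i (\<alpha>(i := b))) =
          (\<Sum>\<alpha>\<in>{\<alpha>\<in>?J. \<alpha> i = a}. \<mu> h \<alpha> * Z G r K V h i (\<alpha>(i := b)))"
        using Z pmf_\<tau>[OF h] by (intro sum.cong) auto
      then show ?thesis
        by (simp only: expected_reward_deviate[OF G prof histsD(4)[OF h] b pos])
    qed
    have "(\<Sum>\<alpha>\<in>{\<alpha>\<in>?J. \<alpha> i = a}. \<mu> h \<alpha> * Z G r K V h i (\<alpha>(i := a'))) \<le>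
        (\<Sum>\<alpha>\<in>{\<alpha>\<in>?J. \<alpha> i = a}. \<mu> h \<alpha> * Z G r K V h i \<alpha>)"
      using ce[OF h] a a' by (simp add: corr_eq_def)
    also have "\<dots> = (\<Sum>\<alpha>\<in>{\<alpha>\<in>?J. \<alpha> i = a}. \<mu> h \<alpha> * Z G r K V h i (\<alpha>(i := a)))"
      by (intro sum.cong) auto
    finally show ?thesis
      unfolding eq[OF a] eq[OF a'] by (rule divide_right_mono) simp
  qed
  then have "is_SPCE G r K s \<tau>"
    using prof by (simp add: is_SPCE_def)
  then show ?thesis
    using pmf_\<tau> V_eq by (auto simp: SPCE_with_payoffs_def)
qed


section \<open>The constraint systems for two agents\<close>

lemma two_agents:
  fixes i j :: "'i::finite"
  assumes "CARD('i) = 2" "i \<noteq> j"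
  shows "UNIV = {i, j}"
proof -
  have "card {i, j} = card (UNIV :: 'i set)"
    using assms by simp
  then show ?thesis
    by (metis card_subset_eq finite subset_UNIV)
qed

lemma other_agent:
  fixes i :: "'i::finite"
  assumes "CARD('i) = 2"
  obtains j where "i \<noteq> j"
proof -
  have "UNIV \<noteq> {i}"
  proof
    assume "UNIV = {i}"
    then have "CARD('i) = card {i}" by simp
    then show False using assms by simp
  qed
  then show ?thesis
    using that by (metis UNIV_eq_I singletonI)
qed

text \<open>The constraint systems quantify over ordered pairs of distinct agents. A condition on
  the first agent alone still reaches every agent, because each one has an opponent.\<close>

lemma other_agent_all:
  assumes "CARD('i::finite) = 2"
  shows "(\<forall>i j::'i. i \<noteq> j \<longrightarrow> P i) \<longleftrightarrow> (\<forall>i. P i)"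
proof
  assume *: "\<forall>i j::'i. i \<noteq> j \<longrightarrow> P i"
  show "\<forall>i. P i"
  proof
    fix i :: 'i
    obtain j where "i \<noteq> j"
      using other_agent[OF assms] .
    with * show "P i" by blast
  qed
qed blast

lemma bij_betw_pair_act:
  fixes i j :: "'i::finite"
  assumes "CARD('i) = 2" "i \<noteq> j"
  shows "bij_betw (\<lambda>(a, b). pair_act i a b) (B i \<times> B j) (joint B)"
proof (rule bij_betw_byWitness[where f' = "\<lambda>\<alpha>. (\<alpha> i, \<alpha> j)"])
  have U: "k = i \<or> k = j" for k
    using two_agents[OF assms] by auto
  show "\<forall>x\<in>B i \<times> B j. (\<lambda>\<alpha>. (\<alpha> i, \<alpha> j)) ((\<lambda>(a, b). pair_act i a b) x) = x"
    using assms(2) by (auto simp: pair_act_def)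
  show "\<forall>\<alpha>\<in>joint B. (\<lambda>(a, b). pair_act i a b) ((\<lambda>\<alpha>. (\<alpha> i, \<alpha> j)) \<alpha>) = \<alpha>"
    using U by (auto simp: pair_act_def fun_eq_iff)
  show "(\<lambda>(a, b). pair_act i a b) ` (B i \<times> B j) \<subseteq> joint B"
    using U assms(2) by (fastforce simp: pair_act_def joint_def)
  show "(\<lambda>\<alpha>. (\<alpha> i, \<alpha> j)) ` joint B \<subseteq> B i \<times> B j"
    by (auto simp: joint_def)
qed

lemma sum_joint_pair_act:
  fixes i j :: "'i::finite"
  assumes "CARD('i) = 2" "i \<noteq> j"
  shows "(\<Sum>\<alpha>\<in>joint B. f \<alpha>) = (\<Sum>(a, b)\<in>B i \<times> B j. f (pair_act i a b))"
  using sum.reindex_bij_betw[OF bij_betw_pair_act[OF assms], of f B]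
  by (simp add: case_prod_unfold)

text \<open>Fixing the action of agent \<open>i\<close> amounts to shrinking its action set to
  \<open>{a}\<close>, which reduces the claim to \<open>sum_joint_pair_act\<close>.\<close>

lemma sum_joint_fixed_pair_act:
  fixes i j :: "'i::finite"
  assumes "CARD('i) = 2" "i \<noteq> j" "a \<in> B i"
  shows "(\<Sum>\<alpha>\<in>{\<alpha>\<in>joint B. \<alpha> i = a}. f \<alpha>) = (\<Sum>b\<in>B j. f (pair_act i a b))"
proof -
  have "{\<alpha>\<in>joint B. \<alpha> i = a} = joint (B(i := {a}))"
    using assms(3) by (auto simp: joint_def fun_upd_def split: if_splits)
  then show ?thesis
    using assms(2) by (simp add: sum_joint_pair_act[OF assms(1,2)] flip: sum.cartesian_product)
qed

section \<open>Normal-form equilibria of two agents\<close>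

lemma mixed_utility_pair_act:
  fixes i j :: "'i::finite"
  assumes "CARD('i) = 2" "i \<noteq> j"
  shows "mixed_utility B u x = (\<Sum>a\<in>B i. x i a * (\<Sum>b\<in>B j. x j b * u (pair_act i a b)))"
proof -
  have "(\<Prod>k\<in>UNIV. x k (pair_act i a b k)) = x i a * x j b" for a b
    unfolding two_agents[OF assms] using assms(2) by (simp add: pair_act_def)
  then show ?thesis
    by (simp add: mixed_utility_def sum_joint_pair_act[OF assms] sum_distrib_left mult.assoc
        flip: sum.cartesian_product)
qed

text \<open>Utility is linear in an agent's own mixed action, so a mixed deviation is an average of
  pure ones and it suffices to compare with those.\<close>

lemma nash_eq_iff_pair_act:
  fixes B :: "'i::finite \<Rightarrow> 'b set"
  assumes card: "CARD('i) = 2" and fin: "\<And>i. finite (B i)"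
    and v: "\<And>i. v i = mixed_utility B (u i) x"
  shows "nash_eq B u x \<longleftrightarrow> (\<forall>i. x i \<in> prob_vecs (B i)) \<and>
    (\<forall>i j. i \<noteq> j \<longrightarrow> (\<forall>a\<in>B i. (\<Sum>b\<in>B j. x j b * u i (pair_act i a b)) \<le> v i))"
    (is "_ \<longleftrightarrow> ?P \<and> ?Q")
proof (intro iffI conjI)
  assume N: "nash_eq B u x"
  then show ?P
    by (simp add: nash_eq_def)
  show ?Q
  proof (intro allI impI ballI)
    fix i j :: 'i and a assume ij: "i \<noteq> j" and a: "a \<in> B i"
    \<comment> \<open>The pure action \<open>a\<close> as a probability vector.\<close>
    let ?y = "\<lambda>a'. of_bool (a' = a) :: real"
    have Int_a: "B i \<inter> {a'. a' = a} = {a}"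
      using a by blast
    have sum_y: "(\<Sum>a'\<in>B i. ?y a' * f a') = f a" for f
      unfolding sum_of_bool_mult_eq[OF fin] Int_a by simp
    have "?y \<in> prob_vecs (B i)"
      using sum_y[of "\<lambda>_. 1"] by (simp add: prob_vecs_def)
    then have "mixed_utility B (u i) (x(i := ?y)) \<le> v i"
      using N by (simp add: nash_eq_def v)
    also have "mixed_utility B (u i) (x(i := ?y)) = (\<Sum>b\<in>B j. x j b * u i (pair_act i a b))"
      using ij sum_y by (simp add: mixed_utility_pair_act[OF card ij])
    finally show "(\<Sum>b\<in>B j. x j b * u i (pair_act i a b)) \<le> v i" .
  qed
next
  assume PQ: "?P \<and> ?Q"
  show "nash_eq B u x"
    unfolding nash_eq_def
  proof (intro conjI allI ballI)
    fix i y assume y: "y \<in> prob_vecs (B i)"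
    obtain j where ij: "i \<noteq> j"
      using other_agent[OF card] .
    have "mixed_utility B (u i) (x(i := y)) =
        (\<Sum>a\<in>B i. y a * (\<Sum>b\<in>B j. x j b * u i (pair_act i a b)))"
      using ij by (simp add: mixed_utility_pair_act[OF card ij])
    also have "\<dots> \<le> (\<Sum>a\<in>B i. y a * v i)"
      using y PQ ij by (intro sum_mono mult_left_mono) (auto simp: prob_vecs_def)
    also have "\<dots> = v i"
      using y by (simp add: prob_vecs_def flip: sum_distrib_right)
    finally show "mixed_utility B (u i) (x(i := y)) \<le> mixed_utility B (u i) x"
      by (simp add: v)
  qed (use PQ in simp)
qed

text \<open>At each history the constraints are the value equation, the absence of profitable pure
  deviations, and normalisation with nonnegativity. Hence every feasible point, not only the initial
  one, is a possible result of backward induction.\<close>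

lemma feasible_N_iff_init_N:
  fixes G :: "('i::finite, 'a) nscsg"
  assumes G: "is_nscsg G" and card: "CARD('i) = 2"
  shows "feasible_N G r K s x \<longleftrightarrow> init_N G r K s x"
proof -
  obtain \<mu> V where x: "x = (\<mu>, V)"
    by (cases x)
  have "(\<forall>i j. i \<noteq> j \<longrightarrow>
       (let Ai = choices G (last_st h) i; Aj = choices G (last_st h) j in
         V h i - (\<Sum>(ai, aj)\<in>Ai \<times> Aj. \<mu> h i ai * \<mu> h j aj * Z G r K V h i (pair_act i ai aj)) = 0 \<and>
         (\<forall>ai\<in>Ai. V h i - (\<Sum>aj\<in>Aj. \<mu> h j aj * Z G r K V h i (pair_act i ai aj)) \<ge> 0) \<and>
         (\<Sum>ai\<in>Ai. \<mu> h i ai) = 1 \<and>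
         (\<forall>ai\<in>Ai. \<mu> h i ai \<ge> 0))) \<longleftrightarrow>
      nash_eq (choices G (last_st h)) (Z G r K V h) (\<mu> h) \<and>
      (\<forall>i. V h i = mixed_utility (choices G (last_st h)) (Z G r K V h i) (\<mu> h))"
    (is "?L \<longleftrightarrow> ?R") if h: "h \<in> hists_lt_from G K s" for h
  proof -
    let ?B = "choices G (last_st h)" and ?u = "Z G r K V h"
    have fin: "finite (?B i)" for i
      using h by (intro finite_choices_last[OF G]) (simp add: hists_lt_from_def hists_lt_def)
    have val: "(\<Sum>(ai, aj)\<in>?B i \<times> ?B j. \<mu> h i ai * \<mu> h j aj * ?u i (pair_act i ai aj)) =
        mixed_utility ?B (?u i) (\<mu> h)" if "i \<noteq> j" for i j
      by (simp add: mixed_utility_pair_act[OF card that] sum_distrib_left mult.assoc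
          flip: sum.cartesian_product)
    have "?L \<longleftrightarrow> (\<forall>i j. i \<noteq> j \<longrightarrow> V h i = mixed_utility ?B (?u i) (\<mu> h) \<and>
        (\<forall>a\<in>?B i. (\<Sum>b\<in>?B j. \<mu> h j b * ?u i (pair_act i a b)) \<le> V h i) \<and>
        \<mu> h i \<in> prob_vecs (?B i))"
      by (intro all_cong1 imp_cong refl) (auto simp: Let_def val prob_vecs_def)
    also have "\<dots> \<longleftrightarrow> (\<forall>i. V h i = mixed_utility ?B (?u i) (\<mu> h)) \<and>
        (\<forall>i j. i \<noteq> j \<longrightarrow> (\<forall>a\<in>?B i. (\<Sum>b\<in>?B j. \<mu> h j b * ?u i (pair_act i a b)) \<le> V h i)) \<and>
        (\<forall>i. \<mu> h i \<in> prob_vecs (?B i))"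
      \<comment> \<open>The value equation and the condition on \<open>\<mu> h i\<close> mention
        only the first agent of a pair, so their quantifiers collapse to one over
        \<open>i\<close>.\<close>
      unfolding all_conj_distrib imp_conjR other_agent_all[OF card] ..
    also have "\<dots> \<longleftrightarrow> ?R"
    proof -
      \<comment> \<open>\<open>nash_eq_iff_pair_act\<close> speaks of values that satisfy the value
        equation, so it is applied under that conjunct.\<close>
      have conj: "(c \<Longrightarrow> n \<longleftrightarrow> a \<and> b) \<Longrightarrow> c \<and> b \<and> a \<longleftrightarrow> n \<and> c" for a b c n
        by blast
      show ?thesis
        by (rule conj) (rule nash_eq_iff_pair_act[OF card fin], blast)
    qed
    finally show ?thesis .
  qed
  then show ?thesis
    unfolding x feasible_N_def init_N_def prod.case by (rule ball_cong[OF refl])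
qed

text \<open>With the action of \<open>i\<close> fixed to \<open>a\<close>, both sums run over the
  opponent's actions, and replacing \<open>a\<close> by \<open>a'\<close> changes one entry of the
  pair; the two sides then merge into one sum of differences.\<close>

lemma corr_eq_iff_pair_act:
  fixes B :: "'i::finite \<Rightarrow> 'b set"
  assumes card: "CARD('i) = 2"
  shows "corr_eq B u p \<longleftrightarrow> p \<in> prob_vecs (joint B) \<and>
    (\<forall>i j. i \<noteq> j \<longrightarrow> (\<forall>a\<in>B i. \<forall>a'\<in>B i.
      (\<Sum>b\<in>B j. (u i (pair_act i a b) - u i (pair_act i a' b)) * p (pair_act i a b)) \<ge> 0))"
proof -
  have upd: "(pair_act i a b)(i := a') = pair_act i a' b" for i :: 'i and a a' b :: 'b
    by (auto simp: pair_act_def)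
  have "(\<Sum>\<alpha>\<in>{\<alpha>\<in>joint B. \<alpha> i = a}. p \<alpha> * u i \<alpha>) \<ge>
        (\<Sum>\<alpha>\<in>{\<alpha>\<in>joint B. \<alpha> i = a}. p \<alpha> * u i (\<alpha>(i := a'))) \<longleftrightarrow>
      (\<Sum>b\<in>B j. (u i (pair_act i a b) - u i (pair_act i a' b)) * p (pair_act i a b)) \<ge> 0"
    if "i \<noteq> j" "a \<in> B i" for i j a a'
    by (simp add: sum_joint_fixed_pair_act[OF card, where B = B, OF that] upd sum_subtractf algebra_simps)
  then have "(\<forall>i j. i \<noteq> j \<longrightarrow> (\<forall>a\<in>B i. \<forall>a'\<in>B i.
        (\<Sum>\<alpha>\<in>{\<alpha>\<in>joint B. \<alpha> i = a}. p \<alpha> * u i \<alpha>)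
          \<ge> (\<Sum>\<alpha>\<in>{\<alpha>\<in>joint B. \<alpha> i = a}. p \<alpha> * u i (\<alpha>(i := a'))))) \<longleftrightarrow>
      (\<forall>i j. i \<noteq> j \<longrightarrow> (\<forall>a\<in>B i. \<forall>a'\<in>B i.
        (\<Sum>b\<in>B j. (u i (pair_act i a b) - u i (pair_act i a' b)) * p (pair_act i a b)) \<ge> 0))"
    by (intro all_cong1 imp_cong ball_cong refl)
  then show ?thesis
    unfolding corr_eq_def other_agent_all[OF card] by (rule arg_cong)
qed

lemma feasible_C_iff_init_C:
  fixes G :: "('i::finite, 'a) nscsg"
  assumes card: "CARD('i) = 2"
  shows "feasible_C G r K s x \<longleftrightarrow> init_C G r K s x"
proof -
  obtain \<mu> V where x: "x = (\<mu>, V)"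
    by (cases x)
  \<comment> \<open>Normalisation and nonnegativity of \<open>\<mu> h\<close> concern neither
    \<open>i\<close> nor \<open>j\<close>, yet stand under the quantifier over pairs; since a pair
    exists, the quantifier can be removed.\<close>
  have const: "(\<forall>i j::'i. i \<noteq> j \<longrightarrow> Q) \<longleftrightarrow> Q" for Q
    using other_agent_all[OF card, of "\<lambda>_. Q"] by simp
  show ?thesis
    unfolding x feasible_C_def init_C_def corr_eq_iff_pair_act[OF card] prob_vecs_def corr_utility_def
      Let_def prod.case all_conj_distrib imp_conjR const other_agent_all[OF card] mem_Collect_eq
    by auto
qed


section \<open>Iterations of FSI\<close>

text \<open>This makes a feasible current point a candidate in its own frozen program.\<close>

lemma keeps_frozen_N_refl: "keeps_frozen_N G K s h x x"
  by (auto simp: keeps_frozen_N_def)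

lemma keeps_frozen_C_refl: "keeps_frozen_C G K s h x x"
  by (auto simp: keeps_frozen_C_def)

text \<open>The initial point is feasible because backward induction yields exactly the feasible
  points; for every later point feasibility is part of being a maximiser.\<close>

lemma FSI_N_feasible:
  fixes G :: "('i::finite, 'a) nscsg"
  assumes "is_nscsg G" "CARD('i) = 2" "FSI_N G r K s m_max sel x" "m \<le> m_max"
  shows "feasible_N G r K s (x m)"
proof (cases m)
  case 0
  then show ?thesis
    using assms by (simp add: FSI_N_def feasible_N_iff_init_N)
next
  case (Suc k)
  then show ?thesis
    using assms by (simp add: FSI_N_def improve_N_def is_arg_max_def)
qed

lemma FSI_C_feasible:
  fixes G :: "('i::finite, 'a) nscsg"
  assumes "CARD('i) = 2" "FSI_C G r K s m_max sel x" "m \<le> m_max"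
  shows "feasible_C G r K s (x m)"
proof (cases m)
  case 0
  then show ?thesis
    using assms by (simp add: FSI_C_def feasible_C_iff_init_C)
next
  case (Suc k)
  then show ?thesis
    using assms by (simp add: FSI_C_def improve_C_def is_arg_max_def)
qed

lemma mono_on_atMost_nat:
  fixes f :: "nat \<Rightarrow> 'c::order"
  assumes "\<And>m. m < n \<Longrightarrow> f m \<le> f (Suc m)"
  shows "mono_on {..n} f"
proof (rule mono_onI)
  fix k m assume "m \<in> {..n}" "k \<le> m"
  \<comment> \<open>The bound on the upper index is carried through the induction, because single
    steps are controlled only below \<open>n\<close>.\<close>
  from this(2,1) show "f k \<le> f m"
  proof (induction rule: dec_induct)
    case (step m)
    then show ?case
      using assms[of m] by force
  qed simp
qed

text \<open>The point \<open>x m\<close> is feasible and agrees with its own frozen values, so it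
  competes with \<open>x (Suc m)\<close>, which is optimal.\<close>

lemma FSI_N_welfare_mono:
  fixes G :: "('i::finite, 'a) nscsg"
  assumes "is_nscsg G" "CARD('i) = 2" "FSI_N G r K s m_max sel x"
  shows "mono_on {..m_max} (\<lambda>m. welfare r K s (snd (x m)))"
proof (rule mono_on_atMost_nat)
  fix m assume m: "m < m_max"
  then have "improve_N G r K s (sel m) (x m) (x (Suc m))"
    using assms(3) by (simp add: FSI_N_def)
  then show "welfare r K s (snd (x m)) \<le> welfare r K s (snd (x (Suc m)))"
    using FSI_N_feasible[OF assms, of m] m keeps_frozen_N_refl
    unfolding improve_N_def is_arg_max_linorder by (meson less_imp_le)
qed

lemma FSI_C_welfare_mono:
  fixes G :: "('i::finite, 'a) nscsg"
  assumes "CARD('i) = 2" "FSI_C G r K s m_max sel x"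
  shows "mono_on {..m_max} (\<lambda>m. welfare r K s (snd (x m)))"
proof (rule mono_on_atMost_nat)
  fix m assume m: "m < m_max"
  then have "improve_C G r K s (sel m) (x m) (x (Suc m))"
    using assms(2) by (simp add: FSI_C_def)
  then show "welfare r K s (snd (x m)) \<le> welfare r K s (snd (x (Suc m)))"
    using FSI_C_feasible[OF assms, of m] m keeps_frozen_C_refl
    unfolding improve_C_def is_arg_max_linorder by (meson less_imp_le)
qed

theorem theorem10:
  fixes G :: "('i::finite, 'a) nscsg" and r :: "('i, 'a) rewards"
    and K :: nat and s :: "'i state"
  assumes "CARD('i) = 2" and "is_nscsg G" and "s \<in> states G"
  shows
    "(\<forall>m_max sel x. FSI_N G r K s m_max sel x \<longrightarrow>
        (\<forall>m\<le>m_max. feasible_N G r K s (x m) \<and> SPNE_with_payoffs G r K s (x m)) \<and>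
        mono_on {..m_max} (\<lambda>m. welfare r K s (snd (x m)))) \<and>
     (\<forall>m_max m_max' sel sel' x x'.
        FSI_N G r K s m_max sel x \<longrightarrow> FSI_N G r K s m_max' sel' x' \<longrightarrow> m_max \<le> m_max' \<longrightarrow>
        same_choices m_max sel x sel' x' \<longrightarrow>
        welfare r K s (snd (x m_max)) \<le> welfare r K s (snd (x' m_max'))) \<and>
     (\<forall>m_max sel x. FSI_C G r K s m_max sel x \<longrightarrow>
        (\<forall>m\<le>m_max. feasible_C G r K s (x m) \<and> SPCE_with_payoffs G r K s (x m)) \<and>
        mono_on {..m_max} (\<lambda>m. welfare r K s (snd (x m)))) \<and>
     (\<forall>m_max m_max' sel sel' x x'.
        FSI_C G r K s m_max sel x \<longrightarrow> FSI_C G r K s m_max' sel' x' \<longrightarrow> m_max \<le> m_max' \<longrightarrow>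
        same_choices m_max sel x sel' x' \<longrightarrow>
        welfare r K s (snd (x m_max)) \<le> welfare r K s (snd (x' m_max')))"
proof (intro conjI allI impI)
  fix m_max sel and x :: "nat \<Rightarrow> ('i, 'a) mixN \<times> ('i, 'a) vals" and m
  assume "FSI_N G r K s m_max sel x" "m \<le> m_max"
  then show feas: "feasible_N G r K s (x m)"
    by (rule FSI_N_feasible[OF assms(2,1)])
  show "SPNE_with_payoffs G r K s (x m)"
    using init_N_SPNE_with_payoffs[OF assms(2), of r K s "fst (x m)" "snd (x m)"] feas
    by (simp add: feasible_N_iff_init_N[OF assms(2,1)])
next
  fix m_max sel and x :: "nat \<Rightarrow> ('i, 'a) mixC \<times> ('i, 'a) vals" and m
  assume "FSI_C G r K s m_max sel x" "m \<le> m_max"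
  then show feas: "feasible_C G r K s (x m)"
    by (rule FSI_C_feasible[OF assms(1)])
  show "SPCE_with_payoffs G r K s (x m)"
    using init_C_SPCE_with_payoffs[OF assms(2), of r K s "fst (x m)" "snd (x m)"] feas
    by (simp add: feasible_C_iff_init_C[OF assms(1)])
next
  fix m_max sel and x :: "nat \<Rightarrow> ('i, 'a) mixN \<times> ('i, 'a) vals"
  assume "FSI_N G r K s m_max sel x"
  then show "mono_on {..m_max} (\<lambda>m. welfare r K s (snd (x m)))"
    by (rule FSI_N_welfare_mono[OF assms(2,1)])
next
  fix m_max sel and x :: "nat \<Rightarrow> ('i, 'a) mixC \<times> ('i, 'a) vals"
  assume "FSI_C G r K s m_max sel x"
  then show "mono_on {..m_max} (\<lambda>m. welfare r K s (snd (x m)))"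
    by (rule FSI_C_welfare_mono[OF assms(1)])
next
  fix m_max m_max' sel sel' and x x' :: "nat \<Rightarrow> ('i, 'a) mixN \<times> ('i, 'a) vals"
  assume "FSI_N G r K s m_max' sel' x'" "m_max \<le> m_max'" "same_choices m_max sel x sel' x'"
  then show "welfare r K s (snd (x m_max)) \<le> welfare r K s (snd (x' m_max'))"
    \<comment> \<open>\<open>same_choices\<close> gives \<open>x' m_max = x m_max\<close>, so both
      welfare values belong to the longer run, whose monotonicity compares them.\<close>
    using FSI_N_welfare_mono[OF assms(2,1), THEN mono_onD, of r K s m_max' sel' x' m_max m_max']
    by (simp add: same_choices_def)
next
  fix m_max m_max' sel sel' and x x' :: "nat \<Rightarrow> ('i, 'a) mixC \<times> ('i, 'a) vals"
  assume "FSI_C G r K s m_max' sel' x'" "m_max \<le> m_max'" "same_choices m_max sel x sel' x'"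
  then show "welfare r K s (snd (x m_max)) \<le> welfare r K s (snd (x' m_max'))"
    using FSI_C_welfare_mono[OF assms(1), THEN mono_onD, of G r K s m_max' sel' x' m_max m_max']
    by (simp add: same_choices_def)
qed

end
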